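(* Let $\mathsf{A}=\{A_1,A_2,\ldots,A_N\}$ be a finite set of $2\times 2$ complex matrices whose joint spectral radius satisfies $\varrho(\mathsf{A})=1$. Then: (i) If the matrices $A_1,\ldots,A_N$ do not share a common eigenvector, or if the set $\{A_j : |\det A_j|=1\}$ is simultaneously diagonalisable, then there exists a constant $C>0$ such that for every sequence $\sigma\colon\mathbb{N}\to\{1,\ldots,N\}$ and every vector $v\in\mathbb{C}^2$ we have $\|A_{\sigma(n)}\cdots A_{\sigma(1)}v\|\leq C\|v\|$ for all $n\geq 1$. (ii) If the matrices $A_1,\ldots,A_N$ share a common eigenvector and additionally the set $\{A_j : |\det A_j|=1\}$ is not simultaneously diagonalisable, then there exist a sequence $\hat\sigma\colon\mathbb{N}\to\{1,\ldots,N\}$ and a nonzero vector $v\in\mathbb{C}^2$ such that \[\liminf_{n\to\infty}\frac{1}{n}\left\|A_{\hat\sigma(n)}\cdots A_{\hat\sigma(1)}v\right\|>0.\] The sequence $\hat\sigma$ may be chosen so that $\{A_{\hat\sigma(n)} : n\geq 1\}$ is not simultaneously diagonalisable, such that $|\det A_{\hat\sigma(n)}|=1$ for every $n\geq 1$, and such that $\hat\sigma$ either is constant or takes exactly two distinct values. Furthermore, for all sequences $\sigma\colon\mathbb{N}\to\{1,\ldots,N\}$ and all vectors $v\in\mathbb{C}^2$, \[\left\|A_{\sigma(n)}\cdots A_{\sigma(1)}v\right\|\leq\left(1+n\cdot\max_{1\leq j\leq N}\|A_j\|\right)\|v\|\] for all $n\geq 1$.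
   Context: $\mathbb{N}=\{1,2,3,\ldots\}$. $\|\cdot\|$ denotes the Euclidean norm on $\mathbb{C}^2$ and the induced operator norm on $2\times 2$ matrices. The joint spectral radius of a bounded nonempty set $\mathsf{A}=\{A_i : i\in\mathcal{I}\}$ of matrices is \[\varrho(\mathsf{A}):=\lim_{n\to\infty}\sup_{i_1,\ldots,i_n\in\mathcal{I}}\|A_{i_n}\cdots A_{i_1}\|^{1/n}=\inf_{n\geq 1}\sup_{i_1,\ldots,i_n\in\mathcal{I}}\|A_{i_n}\cdots A_{i_1}\|^{1/n}.\] A common eigenvector of a set of matrices is a nonzero vector which is an eigenvector of every matrix in the set (the corresponding eigenvalues may differ and may be zero). A set of $2\times 2$ complex matrices is simultaneously diagonalisable if there is a single basis of $\mathbb{C}^2$ in which all matrices of the set are diagonal; the empty set is regarded as simultaneously diagonalisable. *)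

theory Defs
  imports "HOL-Analysis.Analysis"
begin

text \<open>The norm on \<^typ>\<open>complex^'n\<close> is the Euclidean one, so this is the induced operator norm
  (the instance \<^const>\<open>norm\<close> on the matrix type itself is the Frobenius norm).\<close>

definition matrix_norm :: "complex^'n^'n \<Rightarrow> real" where
  "matrix_norm M = onorm ((*v) M)"

text \<open>The product \<open>X n ** \<dots> ** X 1\<close>; the value \<open>X 0\<close> is never used.\<close>

primrec matrix_product :: "(nat \<Rightarrow> complex^'n^'n) \<Rightarrow> nat \<Rightarrow> complex^'n^'n" where
  "matrix_product X 0 = mat 1"
| "matrix_product X (Suc n) = X (Suc n) ** matrix_product X n"

text \<open>For nonempty bounded \<open>S\<close> the limit below exists, by submultiplicativity of the norm; for
  other \<open>S\<close> the value is not meaningful.\<close>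

definition joint_spectral_radius :: "(complex^'n^'n) set \<Rightarrow> real" where
  "joint_spectral_radius S =
     lim (\<lambda>n. SUP X \<in> {1..n} \<rightarrow>\<^sub>E S. root n (matrix_norm (matrix_product X n)))"

definition common_eigenvector :: "(complex^'n^'n) set \<Rightarrow> complex^'n \<Rightarrow> bool" where
  "common_eigenvector S v \<longleftrightarrow> v \<noteq> 0 \<and> (\<forall>M\<in>S. \<exists>c. M *v v = c *s v)"

definition diagonal_matrix :: "complex^'n^'n \<Rightarrow> bool" where
  "diagonal_matrix M \<longleftrightarrow> (\<forall>i j. i \<noteq> j \<longrightarrow> M $ i $ j = 0)"

text \<open>The columns of \<open>P\<close> form the basis in which the matrices become diagonal.\<close>

definition simultaneously_diagonalisable :: "(complex^'n^'n) set \<Rightarrow> bool" where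
  "simultaneously_diagonalisable S \<longleftrightarrow>
     (\<exists>P :: complex^'n^'n. invertible P \<and> (\<forall>M\<in>S. diagonal_matrix (matrix_inv P ** M ** P)))"

end

theory Submission
  imports Defs
begin

text \<open>The joint spectral radius enters only through one consequence: if it is at most \<open>1\<close>, then for
  every \<open>r > 1\<close> and \<open>c > 0\<close> all sufficiently long products have norm below \<open>c * r ^ n\<close>
  (\<open>products_grow_subexponentially\<close>, which rests on Fekete's lemma). In particular no matrix of the
  set has an eigenvalue outside the closed unit disc.

  Suppose there is no common eigenvector. The vectors with bounded orbit under the semigroup of
  products form an invariant subspace. If it is nonzero, it is the whole plane and the semigroup is
  bounded. If it is zero, compactness of the unit sphere gives a length within which every vector
  can be doubled; iterating the doubling gives exponential growth, which is impossible
  (\<open>irreducible_bounded\<close>).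

  Suppose that \<open>e\<close> is a common eigenvector. In a basis \<open>e, f\<close> all matrices are upper triangular,
  with diagonal entries \<open>a, d\<close> in the closed unit disc and an off-diagonal entry \<open>b\<close>. For each
  \<open>C \<ge> 0\<close> the condition \<open>\<bar>b\<bar> \<le> C * (2 - \<bar>a\<bar> - \<bar>d\<bar>)\<close> survives multiplication. A matrix with
  \<open>\<bar>det\<bar> < 1\<close> satisfies it for large \<open>C\<close>, because the right-hand factor is then positive; a matrix
  with \<open>\<bar>det\<bar> = 1\<close> satisfies it only if \<open>b = 0\<close>. If the matrices of the second kind are
  simultaneously diagonalisable, one of their common eigenvectors is not parallel to \<open>e\<close> and can be
  taken as \<open>f\<close>, and boundedness follows (\<open>reducible_bounded\<close>).

  If they are not simultaneously diagonalisable, they act on the slope \<open>x / y\<close> of \<open>x e + y f\<close> by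
  orientation-preserving isometries of the complex plane that have no common fixed point. Either one
  of these is a translation, or two of them are rotations about different points. A translation
  makes the slope grow linearly. So do two rotations: rotate about the first centre until the second
  rotation increases the distance to the first centre by a definite amount, and then apply the
  second rotation (\<open>greedy_escape\<close>, \<open>two_rotations_escape\<close>). Since \<open>\<bar>y\<bar>\<close> is constant, the vectors
  grow linearly (\<open>linear_growth\<close>). The set of matrices used along such a sequence cannot be
  simultaneously diagonalisable, as its products would then be bounded. The growth is at most linear
  because in an orthonormal basis with first vector \<open>e\<close> the off-diagonal entry of a product of length
  \<open>n\<close> is at most the sum of the \<open>n\<close> individual off-diagonal entries
  (\<open>reducible_linear_upper_bound\<close>).\<close>

section \<open>Products of fixed length and the joint spectral radius\<close>

lemma norm_matrix_vector_le: "norm (M *v v) \<le> matrix_norm M * norm (v :: complex^'n)"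
  unfolding matrix_norm_def by (rule onorm) simp

lemma matrix_norm_nonneg: "0 \<le> matrix_norm (M :: complex^'n^'n)"
  unfolding matrix_norm_def by (rule onorm_pos_le) simp

lemma matrix_norm_mult_le:
  "matrix_norm (M ** M') \<le> matrix_norm M * matrix_norm (M' :: complex^'n^'n)"
proof -
  have "(*v) (M ** M') = (*v) M \<circ> (*v) M'"
    by (simp add: fun_eq_iff matrix_vector_mul_assoc)
  then show ?thesis
    unfolding matrix_norm_def by (simp add: onorm_compose)
qed

primrec products_of_length :: "(complex^'n^'n) set \<Rightarrow> nat \<Rightarrow> (complex^'n^'n) set" where
  "products_of_length S 0 = {mat 1}"
| "products_of_length S (Suc n) = {B ** P |B P. B \<in> S \<and> P \<in> products_of_length S n}"

lemma matrix_product_cong: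
  "(\<And>k. k \<in> {1..n} \<Longrightarrow> X k = Y k) \<Longrightarrow> matrix_product X n = matrix_product Y n"
  by (induction n) auto

lemma matrix_product_in_products_of_length:
  "(\<And>k. k \<in> {1..n} \<Longrightarrow> X k \<in> S) \<Longrightarrow> matrix_product X n \<in> products_of_length S n"
proof (induction n)
  case (Suc n)
  have "X (Suc n) \<in> S"
    by (rule Suc.prems) simp
  moreover have "matrix_product X n \<in> products_of_length S n"
    by (rule Suc.IH) (auto intro: Suc.prems)
  ultimately show ?case
    by auto
qed simp

lemma products_of_length_eq_image:
  "products_of_length S n = (\<lambda>X. matrix_product X n) ` ({1..n} \<rightarrow>\<^sub>E S)"
proof (induction n)
  case (Suc n)
  show ?case
  proof (intro equalityI subsetI)
    fix Q assume "Q \<in> products_of_length S (Suc n)"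
    then obtain B X where B: "B \<in> S" and X: "X \<in> {1..n} \<rightarrow>\<^sub>E S"
      and Q: "Q = B ** matrix_product X n"
      by (auto simp: Suc.IH)
    let ?Y = "X(Suc n := B)"
    have "?Y \<in> {1..Suc n} \<rightarrow>\<^sub>E S"
      using B X by (auto simp: PiE_iff extensional_def)
    moreover have "matrix_product ?Y n = matrix_product X n"
      by (rule matrix_product_cong) auto
    ultimately show "Q \<in> (\<lambda>X. matrix_product X (Suc n)) ` ({1..Suc n} \<rightarrow>\<^sub>E S)"
      using Q by (intro image_eqI[of _ _ ?Y]) auto
  next
    fix Q assume "Q \<in> (\<lambda>X. matrix_product X (Suc n)) ` ({1..Suc n} \<rightarrow>\<^sub>E S)"
    then obtain X where "X \<in> {1..Suc n} \<rightarrow>\<^sub>E S" "Q = matrix_product X (Suc n)"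
      by blast
    then show "Q \<in> products_of_length S (Suc n)"
      by (metis PiE_mem matrix_product_in_products_of_length)
  qed
qed auto

lemma products_of_length_finite: "finite S \<Longrightarrow> finite (products_of_length S n)"
  unfolding products_of_length_eq_image by (intro finite_imageI finite_PiE) auto

lemma products_of_length_nonempty: "S \<noteq> {} \<Longrightarrow> products_of_length S n \<noteq> {}"
  by (induction n) auto

lemma products_of_length_add:
  "products_of_length S (m + n) =
     {P ** Q |P Q. P \<in> products_of_length S m \<and> Q \<in> products_of_length S n}"
proof (induction m)
  case (Suc m)
  show ?case
  proof (intro equalityI subsetI)
    fix R assume "R \<in> products_of_length S (Suc m + n)"
    then obtain B P Q where "B \<in> S" "P \<in> products_of_length S m" "Q \<in> products_of_length S n"
      and "R = B ** (P ** Q)"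
      by (auto simp: Suc.IH)
    moreover from this have "R = (B ** P) ** Q"
      by (simp add: matrix_mul_assoc)
    moreover have "B ** P \<in> products_of_length S (Suc m)"
      using \<open>B \<in> S\<close> \<open>P \<in> products_of_length S m\<close> by auto
    ultimately show "R \<in> {P ** Q |P Q. P \<in> products_of_length S (Suc m) \<and> Q \<in> products_of_length S n}"
      by blast
  next
    fix R assume "R \<in> {P ** Q |P Q. P \<in> products_of_length S (Suc m) \<and> Q \<in> products_of_length S n}"
    then obtain B P Q where "B \<in> S" "P \<in> products_of_length S m" "Q \<in> products_of_length S n"
      and "R = (B ** P) ** Q"
      by auto
    moreover from this have "R = B ** (P ** Q)"
      by (simp add: matrix_mul_assoc)
    moreover have "P ** Q \<in> products_of_length S (m + n)"
      using calculation by (auto simp: Suc.IH)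
    ultimately show "R \<in> products_of_length S (Suc m + n)"
      unfolding add_Suc products_of_length.simps by blast
  qed
qed simp

lemma products_of_length_one: "B \<in> S \<Longrightarrow> B \<in> products_of_length S 1"
  by (auto intro: exI[of _ B])

lemma products_of_length_constant:
  "B \<in> S \<Longrightarrow> matrix_product (\<lambda>_. B) n \<in> products_of_length S n"
  by (rule matrix_product_in_products_of_length)

text \<open>Fekete's lemma in multiplicative form. If \<open>M m \<le> s ^ m\<close> for a single \<open>m\<close>, then splitting a length
  into blocks of size \<open>m\<close> and a remainder gives \<open>M n \<le> K * s ^ n\<close> for all \<open>n\<close>; hence the roots converge
  to their infimum. Logarithms are avoided since \<open>M\<close> may vanish (nilpotent matrices).\<close>

lemma submultiplicative_root_convergent:
  fixes M :: "nat \<Rightarrow> real"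
  assumes nonneg: "\<And>n. 0 \<le> M n" and submult: "\<And>m n. M (m + n) \<le> M m * M n"
  shows "convergent (\<lambda>n. root n (M n))"
proof -
  define \<rho> where "\<rho> = (INF n\<in>{1..}. root n (M n))"
  have bdd: "bdd_below ((\<lambda>n. root n (M n)) ` {1..})"
    by (rule bdd_belowI[of _ 0]) (use nonneg in auto)
  have lower: "\<rho> \<le> root n (M n)" if "n \<ge> 1" for n
    unfolding \<rho>_def by (rule cINF_lower[OF bdd]) (use that in simp)
  have "\<rho> \<ge> 0"
    unfolding \<rho>_def by (rule cINF_greatest) (use nonneg in auto)
  have multiple: "M (q * m + r) \<le> M m ^ q * M r" for q m r
  proof (induction q)
    case (Suc q)
    have "M (Suc q * m + r) \<le> M m * M (q * m + r)"
      using submult[of m "q * m + r"] by (simp add: algebra_simps)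
    also have "\<dots> \<le> M m * (M m ^ q * M r)"
      by (intro mult_left_mono Suc.IH nonneg)
    finally show ?case by (simp add: algebra_simps)
  qed simp
  \<comment> \<open>The block length \<open>m\<close> comes from the definition of the infimum; \<open>K\<close> absorbs the remainders \<open>r < m\<close>.\<close>
  have upper: "eventually (\<lambda>n. root n (M n) < t) sequentially" if "t > \<rho>" for t
  proof -
    define s where "s = (\<rho> + t) / 2"
    have s: "\<rho> < s" "s < t" "0 < s"
      using that \<open>\<rho> \<ge> 0\<close> by (auto simp: s_def)
    obtain m where m: "m \<ge> 1" "root m (M m) < s"
      using cINF_less_iff[OF _ bdd, of s] s(1) unfolding \<rho>_def by auto
    have "M m = root m (M m) ^ m"
      using m nonneg by simp
    also have "\<dots> \<le> s ^ m"
      using m nonneg by (intro power_mono) auto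
    finally have Mm: "M m \<le> s ^ m" .
    define K where "K = 1 + (\<Sum>r<m. M r / s ^ r)"
    have terms: "0 \<le> M r / s ^ r" for r
      using nonneg s by simp
    have "K > 0"
      unfolding K_def using sum_nonneg[of "{..<m}" "\<lambda>r. M r / s ^ r"] terms by fastforce
    have K: "M r \<le> K * s ^ r" if "r < m" for r
    proof -
      have "M r / s ^ r \<le> (\<Sum>r<m. M r / s ^ r)"
        by (rule member_le_sum) (use that terms in auto)
      then have "M r / s ^ r \<le> K" by (simp add: K_def)
      then show ?thesis using s by (simp add: pos_divide_le_eq)
    qed
    have growth: "M n \<le> K * s ^ n" for n
    proof -
      define q r where "q = n div m" and "r = n mod m"
      have n: "n = q * m + r" and "r < m"
        using m by (auto simp: q_def r_def)
      have "M n \<le> M m ^ q * M r"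
        unfolding n by (rule multiple)
      also have "\<dots> \<le> (s ^ m) ^ q * (K * s ^ r)"
        by (intro mult_mono power_mono Mm K \<open>r < m\<close> nonneg zero_le_power) (use s in auto)
      also have "\<dots> = K * s ^ n"
        by (simp add: n power_add power_mult mult.commute)
      finally show ?thesis .
    qed
    have "(\<lambda>n. root n K * s) \<longlonglongrightarrow> 1 * s"
      by (intro tendsto_mult LIMSEQ_root_const \<open>K > 0\<close> tendsto_const)
    then have "eventually (\<lambda>n. root n K * s < t) sequentially"
      by (rule order_tendstoD) (use s in simp)
    then show ?thesis
      using eventually_ge_at_top[of 1]
    proof eventually_elim
      case (elim n)
      have "root n (M n) \<le> root n (K * s ^ n)"
        by (rule real_root_le_mono) (use elim growth in auto)
      also have "\<dots> = root n K * s"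
        using elim s by (simp add: real_root_mult real_root_power_cancel)
      finally show ?case using elim by simp
    qed
  qed
  have "(\<lambda>n. root n (M n)) \<longlonglongrightarrow> \<rho>"
  proof (rule order_tendstoI)
    show "eventually (\<lambda>n. a < root n (M n)) sequentially" if "a < \<rho>" for a
      using eventually_ge_at_top[of 1] by eventually_elim (use lower that in fastforce)
  qed (rule upper)
  then show ?thesis
    by (auto simp: convergent_def)
qed

definition max_product_norm :: "(complex^'n^'n) set \<Rightarrow> nat \<Rightarrow> real" where
  "max_product_norm S n = Max (matrix_norm ` products_of_length S n)"

lemma matrix_norm_le_max_product_norm:
  "finite S \<Longrightarrow> P \<in> products_of_length S n \<Longrightarrow> matrix_norm P \<le> max_product_norm S n"
  unfolding max_product_norm_def by (simp add: products_of_length_finite)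

text \<open>The joint spectral radius is defined by a limit operator, which says nothing until the sequence
  is known to converge; submultiplicativity of the maximal norm supplies this.\<close>

lemma joint_spectral_radius_tendsto:
  fixes S :: "(complex^'n^'n) set"
  assumes "finite S" "S \<noteq> {}"
  shows "(\<lambda>n. root n (max_product_norm S n)) \<longlonglongrightarrow> joint_spectral_radius S"
proof -
  let ?M = "max_product_norm S"
  have attained: "\<exists>P\<in>products_of_length S n. ?M n = matrix_norm P" for n
  proof -
    have "?M n \<in> matrix_norm ` products_of_length S n"
      unfolding max_product_norm_def using assms
      by (intro Max_in) (auto simp: products_of_length_finite products_of_length_nonempty)
    then show ?thesis by auto
  qed
  have nonneg: "0 \<le> ?M n" for n
    using attained[of n] matrix_norm_nonneg by auto
  have submult: "?M (m + n) \<le> ?M m * ?M n" for m n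
  proof -
    obtain R where R: "R \<in> products_of_length S (m + n)" "?M (m + n) = matrix_norm R"
      using attained by blast
    then obtain P Q where PQ: "P \<in> products_of_length S m" "Q \<in> products_of_length S n"
      and "R = P ** Q"
      by (auto simp: products_of_length_add)
    then have "matrix_norm R \<le> matrix_norm P * matrix_norm Q"
      by (simp add: matrix_norm_mult_le)
    also have "\<dots> \<le> ?M m * ?M n"
      using PQ assms
      by (intro mult_mono matrix_norm_le_max_product_norm matrix_norm_nonneg nonneg) auto
    finally show ?thesis using R by simp
  qed
  have sup: "(SUP X \<in> {1..n} \<rightarrow>\<^sub>E S. root n (matrix_norm (matrix_product X n))) = root n (?M n)"
    if "n \<ge> 1" for n
  proof -
    have "(SUP X \<in> {1..n} \<rightarrow>\<^sub>E S. root n (matrix_norm (matrix_product X n)))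
        = Sup ((\<lambda>P. root n (matrix_norm P)) ` products_of_length S n)"
      by (simp add: products_of_length_eq_image image_image)
    also have "\<dots> = root n (?M n)"
    proof (rule cSup_eq_maximum)
      show "root n (?M n) \<in> (\<lambda>P. root n (matrix_norm P)) ` products_of_length S n"
        using attained[of n] by auto
      show "x \<le> root n (?M n)" if "x \<in> (\<lambda>P. root n (matrix_norm P)) ` products_of_length S n" for x
        using that \<open>n \<ge> 1\<close> assms by (auto intro!: real_root_le_mono matrix_norm_le_max_product_norm)
    qed
    finally show ?thesis .
  qed
  obtain L where L: "(\<lambda>n. root n (?M n)) \<longlonglongrightarrow> L"
    using submultiplicative_root_convergent[of ?M] nonneg submult by (auto simp: convergent_def)
  have "(\<lambda>n. SUP X \<in> {1..n} \<rightarrow>\<^sub>E S. root n (matrix_norm (matrix_product X n))) \<longlonglongrightarrow> L"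
  proof (rule Lim_transform_eventually[OF L])
    show "eventually (\<lambda>n. root n (?M n) =
        (SUP X \<in> {1..n} \<rightarrow>\<^sub>E S. root n (matrix_norm (matrix_product X n)))) sequentially"
      using eventually_ge_at_top[of 1] by eventually_elim (rule sup[symmetric])
  qed
  then have "joint_spectral_radius S = L"
    unfolding joint_spectral_radius_def by (rule limI)
  then show ?thesis using L by simp
qed

text \<open>The only form in which the joint spectral radius is used: growth at any rate \<open>r > 1\<close> along
  arbitrarily long products is excluded, even up to a constant factor \<open>c\<close>.\<close>

lemma products_grow_subexponentially:
  fixes S :: "(complex^'n^'n) set"
  assumes "finite S" "S \<noteq> {}" and "joint_spectral_radius S \<le> 1" and "r > 1" "c > 0"
  shows "eventually (\<lambda>n. \<forall>P\<in>products_of_length S n. matrix_norm P < c * r ^ n) sequentially"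
proof -
  define s where "s = (1 + r) / 2"
  have s: "1 < s" "s < r"
    using \<open>r > 1\<close> by (auto simp: s_def)
  have "eventually (\<lambda>n. root n (max_product_norm S n) < s) sequentially"
    by (rule order_tendstoD[OF joint_spectral_radius_tendsto]) (use assms s in auto)
  moreover have "(\<lambda>n. (s / r) ^ n) \<longlonglongrightarrow> 0"
    by (rule LIMSEQ_realpow_zero) (use s in auto)
  then have "eventually (\<lambda>n. (s / r) ^ n < c) sequentially"
    by (rule order_tendstoD) (use \<open>c > 0\<close> in simp)
  ultimately show ?thesis
    using eventually_ge_at_top[of 1]
  proof eventually_elim
    case (elim n)
    show ?case
    proof
      fix P assume P: "P \<in> products_of_length S n"
      have "root n (matrix_norm P) \<le> root n (max_product_norm S n)"
        by (rule real_root_le_mono) (use elim P assms matrix_norm_le_max_product_norm in auto)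
      also have "\<dots> < s"
        by (rule elim)
      finally have "root n (matrix_norm P) ^ n \<le> s ^ n"
        using matrix_norm_nonneg[of P] elim by (intro power_mono real_root_ge_zero) auto
      then have "matrix_norm P \<le> s ^ n"
        using elim matrix_norm_nonneg[of P] by simp
      also have "\<dots> < c * r ^ n"
        using elim s by (simp add: power_divide divide_less_eq)
      finally show "matrix_norm P < c * r ^ n" .
    qed
  qed
qed

section \<open>Bases of the complex plane\<close>

text \<open>The determinant of the matrix with columns \<open>e\<close> and \<open>f\<close>: the pair is a basis iff it is nonzero, and
  Cramer's rule expresses coordinates through it.\<close>

definition wedge :: "complex^2 \<Rightarrow> complex^2 \<Rightarrow> complex" where
  "wedge e f = e $ 1 * f $ 2 - e $ 2 * f $ 1"

lemmas plane_simps = vec_eq_iff forall_2 wedge_def matrix_vector_mult_def sum_2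
  vector_smult_component vector_add_component

lemma wedge_linear:
  "wedge e (v + w) = wedge e v + wedge e w" "wedge (v + w) f = wedge v f + wedge w f"
  "wedge e (c *s v) = c * wedge e v" "wedge (c *s v) f = c * wedge v f"
  "wedge e e = 0"
  by (simp_all add: plane_simps algebra_simps)

lemma wedge_mult: "wedge (M *v e) (M *v f) = det M * wedge e f"
  by (simp add: plane_simps det_2 algebra_simps)

lemma norm_wedge_le: "cmod (wedge e f) \<le> 2 * norm e * norm f"
proof -
  have "cmod (wedge e f) \<le> cmod (e $ 1) * cmod (f $ 2) + cmod (e $ 2) * cmod (f $ 1)"
    unfolding wedge_def by (metis norm_mult norm_triangle_ineq4)
  also have "\<dots> \<le> norm e * norm f + norm e * norm f"
    by (intro add_mono mult_mono Finite_Cartesian_Product.norm_nth_le norm_ge_zero)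
  finally show ?thesis by simp
qed

lemma norm_smult: "norm (c *s v) = cmod c * norm (v :: complex^'n)"
  by (simp add: norm_vec_def norm_mult L2_set_left_distrib L2_set_right_distrib)

lemma coordinates:
  assumes "wedge e f \<noteq> 0"
  shows "v = (wedge v f / wedge e f) *s e + (wedge e v / wedge e f) *s f"
proof -
  have "wedge e f *s v = wedge v f *s e + wedge e v *s f"
    by (simp add: plane_simps algebra_simps)
  then have "(1 / wedge e f) *s (wedge e f *s v) = (1 / wedge e f) *s (wedge v f *s e + wedge e v *s f)"
    by simp
  then show ?thesis
    using assms by (simp add: vector_smult_assoc vector_add_ldistrib)
qed

lemma parallel_if_wedge_eq_0:
  assumes "wedge v w = 0" "v \<noteq> 0"
  shows "\<exists>c. w = c *s v"
proof (cases "v $ 1 = 0")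
  case True
  then have "v $ 2 \<noteq> 0"
    using assms by (simp add: plane_simps)
  then show ?thesis
    using assms True by (intro exI[of _ "w $ 2 / v $ 2"]) (auto simp: plane_simps field_simps)
next
  case False
  then show ?thesis
    using assms by (intro exI[of _ "w $ 1 / v $ 1"]) (auto simp: plane_simps field_simps)
qed

text \<open>The constant \<open>K\<close> depends on the basis alone, so that one bound on the images of two basis vectors
  controls a whole family of matrices.\<close>

lemma bounded_on_basis_bounded:
  assumes "wedge e f \<noteq> 0"
  obtains K where "K > 0"
    and "\<And>P :: complex^2^2. \<And>B v. norm (P *v e) \<le> B \<Longrightarrow> norm (P *v f) \<le> B \<Longrightarrow> norm (P *v v) \<le> B * K * norm v"
proof
  define K where "K = 1 + (2 * norm f + 2 * norm e) / cmod (wedge e f)"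
  show "K > 0"
    unfolding K_def by (intro add_pos_nonneg) auto
  fix P :: "complex^2^2" and B v
  assume B: "norm (P *v e) \<le> B" "norm (P *v f) \<le> B"
  have "0 \<le> B"
    using norm_ge_zero B(1) by (rule order_trans)
  let ?x = "wedge v f / wedge e f" and ?y = "wedge e v / wedge e f"
  have "P *v v = ?x *s (P *v e) + ?y *s (P *v f)"
    by (subst coordinates[OF assms, of v]) (simp add: matrix_vector_right_distrib vector_scalar_commute)
  also have "norm \<dots> \<le> cmod ?x * norm (P *v e) + cmod ?y * norm (P *v f)"
    by (metis norm_smult norm_triangle_ineq)
  also have "\<dots> \<le> (2 * norm v * norm f / cmod (wedge e f)) * B
      + (2 * norm e * norm v / cmod (wedge e f)) * B"
    unfolding norm_divide using B \<open>0 \<le> B\<close> norm_wedge_le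
    by (intro add_mono mult_mono divide_right_mono) auto
  also have "\<dots> = B * (K - 1) * norm v"
    by (simp add: K_def add_divide_distrib algebra_simps)
  also have "\<dots> \<le> B * K * norm v"
    by (intro mult_right_mono mult_left_mono) (use \<open>0 \<le> B\<close> in auto)
  finally show "norm (P *v v) \<le> B * K * norm v" .
qed

section \<open>Simultaneous diagonalisation and triangular form\<close>

lemma matrix_inv_inverse:
  assumes "invertible P"
  shows "P ** matrix_inv P = mat 1" "matrix_inv P ** P = mat 1"
  using someI_ex[OF assms[unfolded invertible_def]] by (simp_all add: matrix_inv_def)

text \<open>Passing to eigenvectors removes the inverse matrix from the definition; \<open>e\<close> and \<open>f\<close> are the columns
  of the base change.\<close>

lemma simultaneously_diagonalisable_iff_eigenbasis:
  "simultaneously_diagonalisable (S :: (complex^2^2) set) \<longleftrightarrow>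
     (\<exists>e f. wedge e f \<noteq> 0 \<and> (\<forall>M\<in>S. (\<exists>c. M *v e = c *s e) \<and> (\<exists>c. M *v f = c *s f)))"
proof
  assume "simultaneously_diagonalisable S"
  then obtain P :: "complex^2^2" where P: "invertible P"
    and diag: "\<And>M. M \<in> S \<Longrightarrow> diagonal_matrix (matrix_inv P ** M ** P)"
    by (auto simp: simultaneously_diagonalisable_def)
  let ?e = "column 1 P" and ?f = "column 2 P"
  have "det P = wedge ?e ?f"
    by (simp add: det_2 wedge_def column_def)
  moreover have "det P \<noteq> 0"
    using P by (simp add: invertible_det_nz)
  ultimately have "wedge ?e ?f \<noteq> 0" by simp
  moreover have "(\<exists>c. M *v ?e = c *s ?e) \<and> (\<exists>c. M *v ?f = c *s ?f)" if "M \<in> S" for M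
  proof -
    obtain D where D: "D = matrix_inv P ** M ** P"
      by simp
    have "M ** P = P ** D"
      unfolding D using matrix_inv_inverse(1)[OF P] by (simp add: matrix_mul_assoc)
    then have entry: "(M ** P) $ i $ j = (P ** D) $ i $ j" for i j
      by simp
    have "D $ 1 $ 2 = 0" "D $ 2 $ 1 = 0"
      using diag[OF that] by (auto simp: diagonal_matrix_def D)
    then have "M *v ?e = D $ 1 $ 1 *s ?e" "M *v ?f = D $ 2 $ 2 *s ?f"
      using entry[of 1 1] entry[of 2 1] entry[of 1 2] entry[of 2 2]
      by (simp_all add: plane_simps column_def matrix_matrix_mult_def mult.commute)
    then show ?thesis by blast
  qed
  ultimately show "\<exists>e f. wedge e f \<noteq> 0 \<and>
      (\<forall>M\<in>S. (\<exists>c. M *v e = c *s e) \<and> (\<exists>c. M *v f = c *s f))"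
    by blast
next
  assume "\<exists>e f. wedge e f \<noteq> 0 \<and> (\<forall>M\<in>S. (\<exists>c. M *v e = c *s e) \<and> (\<exists>c. M *v f = c *s f))"
  then obtain e f where "wedge e f \<noteq> 0"
    and eigen: "\<And>M. M \<in> S \<Longrightarrow> (\<exists>c. M *v e = c *s e) \<and> (\<exists>c. M *v f = c *s f)"
    by blast
  define P :: "complex^2^2" where "P = (\<chi> i j. if j = 1 then e $ i else f $ i)"
  have "det P = wedge e f"
    by (simp add: det_2 wedge_def P_def)
  with \<open>wedge e f \<noteq> 0\<close> have P: "invertible P"
    by (simp add: invertible_det_nz)
  have "diagonal_matrix (matrix_inv P ** M ** P)" if "M \<in> S" for M
  proof -
    obtain c d where cd: "M *v e = c *s e" "M *v f = d *s f"
      using eigen[OF \<open>M \<in> S\<close>] by blast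
    define D :: "complex^2^2" where "D = (\<chi> i j. if i = j then (if j = 1 then c else d) else 0)"
    have "M ** P = P ** D"
      using cd by (simp add: plane_simps matrix_matrix_mult_def P_def D_def mult.commute)
    then have "matrix_inv P ** M ** P = D"
      using matrix_inv_inverse(2)[OF P] by (simp add: matrix_mul_assoc[symmetric]) (simp add: matrix_mul_assoc)
    then show ?thesis
      by (simp add: diagonal_matrix_def D_def)
  qed
  with P show "simultaneously_diagonalisable S"
    unfolding simultaneously_diagonalisable_def by blast
qed

text \<open>In the basis \<open>e, f\<close> the matrix \<open>M\<close> has rows \<open>(a, b)\<close> and \<open>(0, d)\<close>. The relation is used instead of
  a conjugated matrix in order to work with varying \<open>f\<close> and without base change.\<close>

definition upper_triangular_on ::
    "complex^2 \<Rightarrow> complex^2 \<Rightarrow> complex^2^2 \<Rightarrow> complex \<Rightarrow> complex \<Rightarrow> complex \<Rightarrow> bool" where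
  "upper_triangular_on e f M a b d \<longleftrightarrow> M *v e = a *s e \<and> M *v f = b *s e + d *s f"

lemma upper_triangular_on_exists:
  assumes "wedge e f \<noteq> 0" "M *v e = a *s e"
  shows "\<exists>b d. upper_triangular_on e f M a b d"
  unfolding upper_triangular_on_def using coordinates[OF assms(1), of "M *v f"] assms(2) by blast

lemma upper_triangular_on_id: "upper_triangular_on e f (mat 1) 1 0 1"
  by (simp add: upper_triangular_on_def)

lemma upper_triangular_on_mult:
  assumes "upper_triangular_on e f M a b d" "upper_triangular_on e f M' a' b' d'"
  shows "upper_triangular_on e f (M ** M') (a * a') (a * b' + b * d') (d * d')"
  using assms unfolding upper_triangular_on_def
  by (simp add: matrix_vector_mul_assoc[symmetric] matrix_vector_right_distrib vector_scalar_commute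
    vector_smult_assoc vector_add_ldistrib vector_sadd_rdistrib add.assoc mult.commute)

lemma upper_triangular_on_apply:
  assumes "upper_triangular_on e f M a b d"
  shows "M *v (x *s e + y *s f) = (a * x + b * y) *s e + (d * y) *s f"
  using assms unfolding upper_triangular_on_def
  by (simp add: matrix_vector_right_distrib vector_scalar_commute
    vector_smult_assoc vector_add_ldistrib vector_sadd_rdistrib add.assoc mult.commute)

lemma upper_triangular_on_det:
  assumes "upper_triangular_on e f M a b d" "wedge e f \<noteq> 0"
  shows "det M = a * d"
proof -
  have "det M * wedge e f = wedge (M *v e) (M *v f)"
    by (simp add: wedge_mult)
  also have "\<dots> = a * d * wedge e f"
    using assms by (simp add: upper_triangular_on_def wedge_linear)
  finally show ?thesis using assms by simp
qed

lemma upper_triangular_on_power: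
  assumes "upper_triangular_on e f M a b d"
  shows "\<exists>b'. upper_triangular_on e f (matrix_product (\<lambda>_. M) n) (a ^ n) b' (d ^ n)"
proof (induction n)
  case 0
  show ?case using upper_triangular_on_id[of e f] by auto
next
  case (Suc n)
  then show ?case
    using upper_triangular_on_mult[OF assms] by fastforce
qed

text \<open>The powers of \<open>M\<close> grow at least like the powers of either eigenvalue: \<open>a ^ n\<close> is seen on \<open>e\<close>
  itself, and \<open>d ^ n\<close> on \<open>f\<close> after the component along \<open>e\<close> is removed by \<open>wedge e\<close>.\<close>

lemma eigenvalues_le_1:
  fixes S :: "(complex^2^2) set"
  assumes "finite S" "joint_spectral_radius S \<le> 1" "M \<in> S"
    and "wedge e f \<noteq> 0" "upper_triangular_on e f M a b d"
  shows "cmod a \<le> 1" "cmod d \<le> 1"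
proof -
  have *: "cmod z \<le> 1" if "c > 0" and "\<And>n. c * cmod z ^ n \<le> matrix_norm (matrix_product (\<lambda>_. M) n)"
    for z c
  proof (rule ccontr)
    assume "\<not> cmod z \<le> 1"
    then have "eventually (\<lambda>n. \<forall>P\<in>products_of_length S n. matrix_norm P < c * cmod z ^ n) sequentially"
      using assms that by (intro products_grow_subexponentially) auto
    then obtain n where "\<forall>P\<in>products_of_length S n. matrix_norm P < c * cmod z ^ n"
      using eventually_happens'[OF sequentially_bot] by blast
    then show False
      using products_of_length_constant[OF \<open>M \<in> S\<close>, of n] that(2)[of n] by (auto simp: not_le)
  qed
  let ?P = "matrix_product (\<lambda>_. M)"
  have ef: "e \<noteq> 0" "f \<noteq> 0"
    using assms(4) by (auto simp: wedge_def)
  show "cmod a \<le> 1"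
  proof (rule *)
    fix n
    obtain b' where "upper_triangular_on e f (?P n) (a ^ n) b' (d ^ n)"
      using upper_triangular_on_power[OF assms(5)] by blast
    then have "cmod a ^ n * norm e = norm (?P n *v e)"
      by (simp add: upper_triangular_on_def norm_smult norm_power)
    also have "\<dots> \<le> matrix_norm (?P n) * norm e"
      by (rule norm_matrix_vector_le)
    finally show "1 * cmod a ^ n \<le> matrix_norm (?P n)"
      using ef by simp
  qed simp
  show "cmod d \<le> 1"
  proof (rule *)
    show "cmod (wedge e f) / (2 * norm e * norm f) > 0"
      using assms(4) ef by simp
    fix n
    obtain b' where "upper_triangular_on e f (?P n) (a ^ n) b' (d ^ n)"
      using upper_triangular_on_power[OF assms(5)] by blast
    then have "cmod d ^ n * cmod (wedge e f) = cmod (wedge e (?P n *v f))"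
      by (simp add: upper_triangular_on_def wedge_linear norm_mult norm_power)
    also have "\<dots> \<le> 2 * norm e * norm (?P n *v f)"
      by (rule norm_wedge_le)
    also have "\<dots> \<le> 2 * norm e * (matrix_norm (?P n) * norm f)"
      by (intro mult_left_mono norm_matrix_vector_le) simp
    finally show "cmod (wedge e f) / (2 * norm e * norm f) * cmod d ^ n \<le> matrix_norm (?P n)"
      using ef by (simp add: field_simps)
  qed
qed

section \<open>Bounded semigroups of products\<close>

definition uniformly_bounded_products :: "(complex^'n^'n) set \<Rightarrow> bool" where
  "uniformly_bounded_products S \<longleftrightarrow>
     (\<exists>C>0. \<forall>n. \<forall>P\<in>products_of_length S n. \<forall>v. norm (P *v v) \<le> C * norm v)"

lemma uniformly_bounded_products_if_bounded_on_basis: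
  fixes S :: "(complex^2^2) set"
  assumes "wedge e f \<noteq> 0"
    and e: "\<And>n P. P \<in> products_of_length S n \<Longrightarrow> norm (P *v e) \<le> B"
    and f: "\<And>n P. P \<in> products_of_length S n \<Longrightarrow> norm (P *v f) \<le> B"
  shows "uniformly_bounded_products S"
proof -
  obtain K where "K > 0" and K: "\<And>P :: complex^2^2. \<And>B v. norm (P *v e) \<le> B \<Longrightarrow> norm (P *v f) \<le> B
      \<Longrightarrow> norm (P *v v) \<le> B * K * norm v"
    by (rule bounded_on_basis_bounded[OF assms(1)]) (rule that)
  have "norm e \<le> B"
    using e[of "mat 1" 0] by simp
  moreover have "norm e > 0"
    using assms(1) by (auto simp: wedge_def)
  ultimately have "B > 0" by linarith
  then show ?thesis
    unfolding uniformly_bounded_products_def using \<open>K > 0\<close> K e f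
    by (intro exI[of _ "B * K"]) auto
qed

text \<open>The case distinction is whether some nonzero vector \<open>v\<close> has a bounded orbit. If so, then \<open>v\<close> and a
  non-parallel image \<open>M v\<close> form a basis of vectors with bounded orbits. If not, every unit vector is
  stretched by more than \<open>2\<close> by some product, of length at most a common \<open>L\<close> by compactness, and
  repeated doubling produces growth at the rate \<open>root L 2 > 1\<close>.\<close>

lemma irreducible_bounded:
  fixes S :: "(complex^2^2) set"
  assumes S: "finite S" "S \<noteq> {}" "joint_spectral_radius S \<le> 1"
    and irreducible: "\<nexists>v. common_eigenvector S v"
  shows "uniformly_bounded_products S"
proof (cases "\<exists>v B. v \<noteq> 0 \<and> (\<forall>n. \<forall>P\<in>products_of_length S n. norm (P *v v) \<le> B)")
  case True
  then obtain v B where "v \<noteq> 0"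
    and B: "\<And>n P. P \<in> products_of_length S n \<Longrightarrow> norm (P *v v) \<le> B"
    by blast
  obtain M where "M \<in> S" and M: "wedge v (M *v v) \<noteq> 0"
    using irreducible \<open>v \<noteq> 0\<close> parallel_if_wedge_eq_0[of v]
    unfolding common_eigenvector_def by metis
  have "norm (P *v (M *v v)) \<le> B" if "P \<in> products_of_length S n" for n P
  proof -
    have "P ** M \<in> products_of_length S (n + 1)"
      unfolding products_of_length_add using that products_of_length_one[OF \<open>M \<in> S\<close>] by blast
    then show ?thesis
      using B[of "P ** M" "n + 1"] by (simp only: matrix_vector_mul_assoc)
  qed
  with M B show ?thesis
    by (intro uniformly_bounded_products_if_bounded_on_basis)
next
  case False
  then have escape: "\<exists>n. \<exists>P\<in>products_of_length S n. norm (P *v v) > 2" if "v \<noteq> 0" for v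
    using that by (meson not_le)
  define U where "U n = (\<Union>P\<in>products_of_length S n. {v. norm (P *v v) > 2})" for n
  have "open (U n)" for n
    unfolding U_def
    by (intro open_UN ballI open_Collect_less continuous_intros linear_continuous_on) auto
  moreover have "sphere 0 1 \<subseteq> (\<Union>n. U n)"
  proof
    fix v :: "complex^2" assume "v \<in> sphere 0 1"
    then have "v \<noteq> 0" by auto
    then show "v \<in> (\<Union>n. U n)"
      using escape by (auto simp: U_def)
  qed
  ultimately obtain F where F: "finite F" "sphere 0 1 \<subseteq> (\<Union>n\<in>F. U n)"
    using compactE_image[OF compact_sphere, of UNIV U] by (metis UNIV_I)
  define L where "L = Max (insert 1 F)"
  have "L \<ge> 1"
    unfolding L_def using F by simp
  have doubling: "\<exists>n P. 1 \<le> n \<and> n \<le> L \<and> P \<in> products_of_length S n \<and> norm (P *v v) \<ge> 2 * norm v"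
    if "v \<noteq> 0" for v
  proof -
    define w where "w = complex_of_real (1 / norm v) *s v"
    have w: "norm w = 1"
      using that by (simp add: w_def norm_smult norm_divide)
    then have "w \<in> sphere 0 1" by simp
    then obtain n P where n: "n \<in> F" and P: "P \<in> products_of_length S n" "norm (P *v w) > 2"
      using F(2) unfolding U_def by blast
    have "n \<le> L"
      unfolding L_def using F n by simp
    moreover have "n \<noteq> 0"
      using P w by (cases n) auto
    moreover have "2 * norm v \<le> norm (P *v v)"
    proof -
      have "norm (P *v w) = norm (P *v v) / norm v"
        by (simp add: w_def vector_scalar_commute norm_smult norm_divide)
      then show ?thesis
        using P that by (simp add: pos_less_divide_eq)
    qed
    ultimately show ?thesis
      using P by (intro exI[of _ n] exI[of _ P]) auto
  qed
  \<comment> \<open>Any unit vector serves as starting point of the doubling.\<close>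
  define v :: "complex^2" where "v = axis 1 1"
  have v: "norm v = 1"
    by (simp add: v_def axis_def norm_vec_def L2_set_def sum_2)
  have long: "\<exists>n P. k \<le> n \<and> n \<le> k * L \<and> P \<in> products_of_length S n \<and> norm (P *v v) \<ge> 2 ^ k" for k
  proof (induction k)
    case 0
    then show ?case
      using v by (intro exI[of _ 0] exI[of _ "mat 1"]) auto
  next
    case (Suc k)
    then obtain n P where n: "k \<le> n" "n \<le> k * L" "P \<in> products_of_length S n"
      and growth: "norm (P *v v) \<ge> 2 ^ k"
      by blast
    have "norm (P *v v) > 0"
      using growth zero_less_power[of "2::real" k] by linarith
    then obtain m Q where m: "1 \<le> m" "m \<le> L" "Q \<in> products_of_length S m"
      and "norm (Q *v (P *v v)) \<ge> 2 * norm (P *v v)"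
      using doubling[of "P *v v"] by auto
    then have "norm ((Q ** P) *v v) \<ge> 2 ^ Suc k"
      using growth by (simp add: matrix_vector_mul_assoc)
    moreover have "Q ** P \<in> products_of_length S (m + n)"
      unfolding products_of_length_add using m n by blast
    ultimately show ?case
      using m n by (intro exI[of _ "m + n"] exI[of _ "Q ** P"]) auto
  qed
  define r where "r = root L 2"
  have r: "r > 1" "r ^ L = 2"
    using \<open>L \<ge> 1\<close> by (auto simp: r_def)
  have "eventually (\<lambda>n. \<forall>P\<in>products_of_length S n. matrix_norm P < 1 * r ^ n) sequentially"
    by (intro products_grow_subexponentially S r) simp
  then obtain k where k: "\<And>n P. n \<ge> k \<Longrightarrow> P \<in> products_of_length S n \<Longrightarrow> matrix_norm P < r ^ n"
    by (auto simp: eventually_sequentially)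
  obtain n P where n: "k \<le> n" "n \<le> k * L" "P \<in> products_of_length S n"
    and growth: "norm (P *v v) \<ge> 2 ^ k"
    using long by blast
  have "r ^ n \<le> r ^ (k * L)"
    using n r by (intro power_increasing) auto
  also have "\<dots> = 2 ^ k"
    using r by (simp add: power_mult mult.commute[of k])
  also have "\<dots> \<le> matrix_norm P"
    using growth norm_matrix_vector_le[of P v] v by simp
  finally show ?thesis
    using k[OF n(1,3)] by simp
qed

text \<open>The bound on \<open>b\<close> is chosen so that it is inherited by products: for factors \<open>(a, b, d)\<close> and \<open>(a', b', d')\<close> the
  two bounds give an entry that falls short of the bound for the product by
  \<open>2 * C * (1 - \<bar>a\<bar>) * (1 - \<bar>d'\<bar>) \<ge> 0\<close>. A
  bound by a multiple of \<open>1 - \<bar>a d\<bar>\<close> would not do: with \<open>a = d' = 1\<close> and \<open>d = a' = 0\<close> the entries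
  \<open>b\<close> and \<open>b'\<close> add up while that quantity does not exceed \<open>1\<close>.\<close>

lemma triangular_products_bounded:
  fixes S :: "(complex^2^2) set"
  assumes "wedge e f \<noteq> 0" "C \<ge> 0"
    and S: "\<And>M. M \<in> S \<Longrightarrow> \<exists>a b d. upper_triangular_on e f M a b d
      \<and> cmod a \<le> 1 \<and> cmod d \<le> 1 \<and> cmod b \<le> C * (2 - cmod a - cmod d)"
  shows "uniformly_bounded_products S"
proof -
  have P: "\<exists>a b d. upper_triangular_on e f P a b d
      \<and> cmod a \<le> 1 \<and> cmod d \<le> 1 \<and> cmod b \<le> C * (2 - cmod a - cmod d)"
    if "P \<in> products_of_length S n" for n P
    using that
  proof (induction n arbitrary: P)
    case 0
    then show ?case
      using upper_triangular_on_id[of e f] by fastforce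
  next
    case (Suc n)
    then obtain M Q where "P = M ** Q" "M \<in> S" "Q \<in> products_of_length S n"
      by auto
    then obtain a b d a' b' d' where "upper_triangular_on e f M a b d" "upper_triangular_on e f Q a' b' d'"
      and bounds: "cmod a \<le> 1" "cmod d \<le> 1" "cmod a' \<le> 1" "cmod d' \<le> 1"
      and b: "cmod b \<le> C * (2 - cmod a - cmod d)" and b': "cmod b' \<le> C * (2 - cmod a' - cmod d')"
      using S[of M] Suc.IH[of Q] by blast
    then have "upper_triangular_on e f P (a * a') (a * b' + b * d') (d * d')"
      unfolding \<open>P = M ** Q\<close> by (intro upper_triangular_on_mult)
    moreover have "cmod (a * b' + b * d') \<le> C * (2 - cmod (a * a') - cmod (d * d'))"
    proof -
      have "cmod (a * b' + b * d') \<le> cmod a * cmod b' + cmod b * cmod d'"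
        by (metis norm_mult norm_triangle_ineq)
      also have "\<dots> \<le> cmod a * (C * (2 - cmod a' - cmod d')) + C * (2 - cmod a - cmod d) * cmod d'"
        by (intro add_mono mult_left_mono mult_right_mono b b') auto
      also have "\<dots> = C * (2 - cmod (a * a') - cmod (d * d')) - 2 * C * ((1 - cmod a) * (1 - cmod d'))"
        by (simp add: norm_mult algebra_simps)
      also have "\<dots> \<le> C * (2 - cmod (a * a') - cmod (d * d'))"
        using bounds \<open>C \<ge> 0\<close> by simp
      finally show ?thesis .
    qed
    moreover have "cmod (a * a') \<le> 1" "cmod (d * d') \<le> 1"
      using bounds by (simp_all add: norm_mult mult_le_one)
    ultimately show ?case by blast
  qed
  define B where "B = norm e + (2 * C * norm e + norm f)"
  show ?thesis
  proof (rule uniformly_bounded_products_if_bounded_on_basis[OF assms(1)])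
    fix n P assume "P \<in> products_of_length S n"
    then obtain a b d where abd: "upper_triangular_on e f P a b d" "cmod a \<le> 1" "cmod d \<le> 1"
      and b: "cmod b \<le> C * (2 - cmod a - cmod d)"
      using P by blast
    have "C * (2 - cmod a - cmod d) \<le> C * 2"
      using \<open>C \<ge> 0\<close> norm_ge_zero[of a] norm_ge_zero[of d] by (intro mult_left_mono) linarith+
    then have b2: "cmod b \<le> 2 * C"
      using b by simp
    have "norm (P *v e) \<le> 1 * norm e"
      using abd by (simp add: upper_triangular_on_def norm_smult mult_left_le_one_le)
    then show "norm (P *v e) \<le> B"
      using \<open>C \<ge> 0\<close> unfolding B_def by (simp add: add_increasing2)
    have "norm (P *v f) \<le> cmod b * norm e + cmod d * norm f"
      using abd unfolding upper_triangular_on_def by (metis norm_smult norm_triangle_ineq)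
    also have "\<dots> \<le> 2 * C * norm e + 1 * norm f"
      by (intro add_mono mult_right_mono b2 abd) auto
    finally show "norm (P *v f) \<le> B"
      unfolding B_def by (simp add: add_increasing)
  qed
qed

text \<open>The degenerate case \<open>C = 0\<close> of the triangular criterion. It will be used in contrapositive form: a
  subset of \<open>S\<close> with an unbounded sequence of products is not simultaneously diagonalisable.\<close>

lemma simultaneously_diagonalisable_bounded:
  fixes S :: "(complex^2^2) set"
  assumes "finite S" "joint_spectral_radius S \<le> 1" "T \<subseteq> S"
    and "simultaneously_diagonalisable T"
  shows "uniformly_bounded_products T"
proof -
  obtain e f where ef: "wedge e f \<noteq> 0"
    and eigen: "\<And>M. M \<in> T \<Longrightarrow> (\<exists>c. M *v e = c *s e) \<and> (\<exists>c. M *v f = c *s f)"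
    using assms(4) by (auto simp: simultaneously_diagonalisable_iff_eigenbasis)
  show ?thesis
  proof (rule triangular_products_bounded[OF ef order_refl])
    fix M assume "M \<in> T"
    then obtain a d where "M *v e = a *s e" "M *v f = d *s f"
      using eigen by blast
    then have "upper_triangular_on e f M a 0 d"
      by (simp add: upper_triangular_on_def)
    moreover from this have "cmod a \<le> 1" "cmod d \<le> 1"
      using eigenvalues_le_1[OF assms(1,2) _ ef] \<open>M \<in> T\<close> assms(3) by blast+
    ultimately show "\<exists>a b d. upper_triangular_on e f M a b d
      \<and> cmod a \<le> 1 \<and> cmod d \<le> 1 \<and> cmod b \<le> 0 * (2 - cmod a - cmod d)"
      by (intro exI[of _ a] exI[of _ 0] exI[of _ d]) simp
  qed
qed

text \<open>Of two independent common eigenvectors of the matrices with \<open>\<bar>det\<bar> = 1\<close>, at least one is not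
  parallel to \<open>e\<close>; with that one as \<open>f\<close> these matrices have \<open>b = 0\<close>. For any other matrix
  \<open>2 - \<bar>a\<bar> - \<bar>d\<bar>\<close> is positive, so an individual constant exists, and finiteness allows a common one.\<close>

lemma reducible_bounded:
  fixes S :: "(complex^2^2) set"
  assumes S: "finite S" "joint_spectral_radius S \<le> 1"
    and e: "common_eigenvector S e"
    and diag: "simultaneously_diagonalisable {M \<in> S. cmod (det M) = 1}"
  shows "uniformly_bounded_products S"
proof -
  obtain g h where gh: "wedge g h \<noteq> 0"
    and eigen: "\<And>M. M \<in> S \<Longrightarrow> cmod (det M) = 1 \<Longrightarrow> (\<exists>c. M *v g = c *s g) \<and> (\<exists>c. M *v h = c *s h)"
    using diag by (auto simp: simultaneously_diagonalisable_iff_eigenbasis)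
  have "e \<noteq> 0"
    using e by (simp add: common_eigenvector_def)
  have "\<exists>f. wedge e f \<noteq> 0 \<and> (\<forall>M\<in>S. cmod (det M) = 1 \<longrightarrow> (\<exists>c. M *v f = c *s f))"
  proof (cases "wedge e h = 0")
    case True
    have "wedge e g \<noteq> 0"
    proof
      assume "wedge e g = 0"
      then obtain x y where "h = x *s e" "g = y *s e"
        using parallel_if_wedge_eq_0[OF _ \<open>e \<noteq> 0\<close>] True by blast
      then show False
        using gh by (simp add: wedge_linear)
    qed
    then show ?thesis
      using eigen by blast
  next
    case False
    then show ?thesis
      using eigen by blast
  qed
  then obtain f where ef: "wedge e f \<noteq> 0"
    and f: "\<And>M. M \<in> S \<Longrightarrow> cmod (det M) = 1 \<Longrightarrow> \<exists>c. M *v f = c *s f"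
    by blast
  have single: "\<exists>a b d C. upper_triangular_on e f M a b d \<and> cmod a \<le> 1 \<and> cmod d \<le> 1
      \<and> 0 \<le> C \<and> cmod b \<le> C * (2 - cmod a - cmod d)" if "M \<in> S" for M
  proof -
    obtain a where a: "M *v e = a *s e"
      using e \<open>M \<in> S\<close> by (auto simp: common_eigenvector_def)
    show ?thesis
    proof (cases "cmod (det M) = 1")
      case True
      then obtain d where "M *v f = d *s f"
        using f \<open>M \<in> S\<close> by blast
      then have "upper_triangular_on e f M a 0 d"
        using a by (simp add: upper_triangular_on_def)
      moreover from this have "cmod a \<le> 1" "cmod d \<le> 1"
        using eigenvalues_le_1[OF S that ef] by blast+
      ultimately show ?thesis
        by (intro exI[of _ a] exI[of _ 0] exI[of _ d]) simp
    next
      case False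
      obtain b d where abd: "upper_triangular_on e f M a b d"
        using upper_triangular_on_exists[OF ef a] by blast
      then have le: "cmod a \<le> 1" "cmod d \<le> 1"
        using eigenvalues_le_1[OF S that ef] by blast+
      have "\<not> (cmod a = 1 \<and> cmod d = 1)"
        using False upper_triangular_on_det[OF abd ef] by (auto simp: norm_mult)
      then have "2 - cmod a - cmod d > 0"
        using le by linarith
      then show ?thesis
        using abd le
        by (intro exI[of _ a] exI[of _ b] exI[of _ d] exI[of _ "cmod b / (2 - cmod a - cmod d)"]) simp
    qed
  qed
  then obtain a b d C where abd: "\<And>M. M \<in> S \<Longrightarrow> upper_triangular_on e f M (a M) (b M) (d M)"
    and le: "\<And>M. M \<in> S \<Longrightarrow> cmod (a M) \<le> 1" "\<And>M. M \<in> S \<Longrightarrow> cmod (d M) \<le> 1"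
    and C: "\<And>M. M \<in> S \<Longrightarrow> 0 \<le> C M"
      "\<And>M. M \<in> S \<Longrightarrow> cmod (b M) \<le> C M * (2 - cmod (a M) - cmod (d M))"
    by metis
  show ?thesis
  proof (rule triangular_products_bounded[OF ef])
    show "sum C S \<ge> 0"
      using C by (simp add: sum_nonneg)
    fix M assume M: "M \<in> S"
    have "cmod (b M) \<le> C M * (2 - cmod (a M) - cmod (d M))"
      using C M by blast
    also have "\<dots> \<le> sum C S * (2 - cmod (a M) - cmod (d M))"
      using le[OF M] C S M by (intro mult_right_mono member_le_sum) auto
    finally show "\<exists>a b d. upper_triangular_on e f M a b d
      \<and> cmod a \<le> 1 \<and> cmod d \<le> 1 \<and> cmod b \<le> sum C S * (2 - cmod a - cmod d)"
      using abd le M by blast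
  qed
qed

section \<open>At most linear growth with a common eigenvector\<close>

lemma common_eigenvector_orthonormal_basis:
  assumes "common_eigenvector S v"
  obtains e f :: "complex^2" where "common_eigenvector S e" "wedge e f = 1"
    and "\<And>x y. (norm (x *s e + y *s f))\<^sup>2 = (cmod x)\<^sup>2 + (cmod y)\<^sup>2"
proof
  have "v \<noteq> 0"
    using assms by (simp add: common_eigenvector_def)
  define e where "e = complex_of_real (1 / norm v) *s v"
  \<comment> \<open>The vector orthogonal to \<open>e\<close> for which the pair has determinant \<open>1\<close>.\<close>
  define f :: "complex^2" where "f = (\<chi> i. if i = 1 then - cnj (e $ 2) else cnj (e $ 1))"
  have "norm e = 1"
    using \<open>v \<noteq> 0\<close> by (simp add: e_def norm_smult norm_divide)
  have norm_square: "(norm w)\<^sup>2 = (cmod (w $ 1))\<^sup>2 + (cmod (w $ 2))\<^sup>2" for w :: "complex^2"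
    by (simp add: norm_vec_def L2_set_def sum_2)
  from \<open>norm e = 1\<close> have unit: "(cmod (e $ 1))\<^sup>2 + (cmod (e $ 2))\<^sup>2 = 1"
    using norm_square[of e] by simp
  have "e \<noteq> 0"
    using \<open>norm e = 1\<close> by auto
  moreover have "\<exists>c. M *v e = c *s e" if "M \<in> S" for M
  proof -
    obtain c where "M *v v = c *s v"
      using assms \<open>M \<in> S\<close> by (auto simp: common_eigenvector_def)
    then have "M *v e = c *s e"
      by (simp add: e_def vector_scalar_commute vector_smult_assoc mult.commute)
    then show ?thesis ..
  qed
  ultimately show "common_eigenvector S e"
    by (simp add: common_eigenvector_def)
  have "wedge e f = complex_of_real ((cmod (e $ 1))\<^sup>2 + (cmod (e $ 2))\<^sup>2)"
    unfolding of_real_add complex_norm_square by (simp add: wedge_def f_def)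
  then show "wedge e f = 1"
    using unit by simp
  fix x y
  have "complex_of_real ((norm (x *s e + y *s f))\<^sup>2)
      = (x * e $ 1 - y * cnj (e $ 2)) * cnj (x * e $ 1 - y * cnj (e $ 2))
        + (x * e $ 2 + y * cnj (e $ 1)) * cnj (x * e $ 2 + y * cnj (e $ 1))"
    unfolding norm_square of_real_add complex_norm_square by (simp add: f_def)
  also have "\<dots> = (x * cnj x + y * cnj y) * (e $ 1 * cnj (e $ 1) + e $ 2 * cnj (e $ 2))"
    by (simp add: algebra_simps)
  also have "\<dots> = complex_of_real (((cmod x)\<^sup>2 + (cmod y)\<^sup>2) * ((cmod (e $ 1))\<^sup>2 + (cmod (e $ 2))\<^sup>2))"
    unfolding of_real_mult of_real_add complex_norm_square ..
  finally show "(norm (x *s e + y *s f))\<^sup>2 = (cmod x)\<^sup>2 + (cmod y)\<^sup>2"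
    unfolding unit of_real_eq_iff by simp
qed

text \<open>Since diagonal entries have modulus at most \<open>1\<close>, off-diagonal entries at most add up under
  multiplication. In an orthonormal basis, moreover, the diagonal part of a product is a
  contraction and each off-diagonal entry is bounded by the operator norm of its matrix.\<close>

lemma reducible_linear_upper_bound:
  fixes S :: "(complex^2^2) set"
  assumes S: "finite S" "joint_spectral_radius S \<le> 1"
    and "common_eigenvector S v\<^sub>0"
    and K: "\<And>M. M \<in> S \<Longrightarrow> matrix_norm M \<le> K"
    and "P \<in> products_of_length S n"
  shows "norm (P *v v) \<le> (1 + real n * K) * norm v"
proof -
  obtain e f where e: "common_eigenvector S e" and wedge: "wedge e f = 1"
    and pythagoras: "\<And>x y. (norm (x *s e + y *s f))\<^sup>2 = (cmod x)\<^sup>2 + (cmod y)\<^sup>2"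
    using common_eigenvector_orthonormal_basis[OF assms(3)] by metis
  have ef: "wedge e f \<noteq> 0"
    using wedge by simp
  have coordinate_le: "cmod x \<le> norm (x *s e + y *s f)" "cmod y \<le> norm (x *s e + y *s f)" for x y
    by (rule power2_le_imp_le; simp add: pythagoras)+
  have "norm e = 1"
    using pythagoras[of 1 0] norm_ge_zero[of e] by (simp add: power2_eq_1_iff)
  have "norm f = 1"
    using pythagoras[of 0 1] norm_ge_zero[of f] by (simp add: power2_eq_1_iff)
  have "\<exists>a b d. upper_triangular_on e f P a b d \<and> cmod a \<le> 1 \<and> cmod d \<le> 1 \<and> cmod b \<le> real n * K"
    using assms(5)
  proof (induction n arbitrary: P)
    case 0
    then show ?case
      using upper_triangular_on_id[of e f] by fastforce
  next
    case (Suc n)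
    then obtain M Q where P: "P = M ** Q" "M \<in> S" "Q \<in> products_of_length S n"
      by auto
    then obtain a' b' d' where Q: "upper_triangular_on e f Q a' b' d'" "cmod a' \<le> 1" "cmod d' \<le> 1"
      and b': "cmod b' \<le> real n * K"
      using Suc.IH by blast
    obtain a where a: "M *v e = a *s e"
      using e P by (auto simp: common_eigenvector_def)
    then obtain b d where M: "upper_triangular_on e f M a b d"
      using upper_triangular_on_exists[OF ef a] by blast
    then have le: "cmod a \<le> 1" "cmod d \<le> 1"
      using eigenvalues_le_1[OF S \<open>M \<in> S\<close> ef] by blast+
    have "cmod b \<le> norm (M *v f)"
      using M coordinate_le by (simp add: upper_triangular_on_def)
    also have "\<dots> \<le> K"
      using norm_matrix_vector_le[of M f] K[OF \<open>M \<in> S\<close>] \<open>norm f = 1\<close> by simp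
    finally have b: "cmod b \<le> K" .
    have "cmod (a * b' + b * d') \<le> cmod a * cmod b' + cmod b * cmod d'"
      by (metis norm_mult norm_triangle_ineq)
    also have "\<dots> \<le> 1 * (real n * K) + K * 1"
      using order_trans[OF norm_ge_zero b] by (intro add_mono mult_mono b b' Q le) auto
    finally have "cmod (a * b' + b * d') \<le> real (Suc n) * K"
      by (simp add: algebra_simps)
    moreover have "cmod (a * a') \<le> 1" "cmod (d * d') \<le> 1"
      using le Q by (simp_all add: norm_mult mult_le_one)
    ultimately show ?case
      using upper_triangular_on_mult[OF M Q(1)] P(1) by blast
  qed
  then obtain a b d where abd: "upper_triangular_on e f P a b d" "cmod a \<le> 1" "cmod d \<le> 1"
    and b: "cmod b \<le> real n * K"
    by blast
  obtain x y where v: "v = x *s e + y *s f"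
    using coordinates[OF ef, of v] by blast
  have "P *v v = ((a * x) *s e + (d * y) *s f) + (b * y) *s e"
    unfolding v upper_triangular_on_apply[OF abd(1)] by (simp add: vector_sadd_rdistrib algebra_simps)
  then have "norm (P *v v) \<le> norm ((a * x) *s e + (d * y) *s f) + norm ((b * y) *s e)"
    by (simp add: norm_triangle_ineq)
  also have "norm ((a * x) *s e + (d * y) *s f) \<le> norm v"
  proof (rule power2_le_imp_le)
    show "(norm ((a * x) *s e + (d * y) *s f))\<^sup>2 \<le> (norm v)\<^sup>2"
      unfolding v pythagoras using abd
      by (intro add_mono power_mono) (simp_all add: norm_mult mult_left_le_one_le)
  qed simp
  also have "norm ((b * y) *s e) \<le> real n * K * norm v"
    unfolding norm_smult norm_mult \<open>norm e = 1\<close> mult_1_right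
    using b coordinate_le(2)[of y x] order_trans[OF norm_ge_zero b] unfolding v[symmetric]
    by (intro mult_mono) auto
  finally show ?thesis
    by (simp add: algebra_simps)
qed

section \<open>Escaping along two rotations of the plane\<close>

text \<open>If the orbit of \<open>q\<close> stayed in the closed left half plane, the real parts would be of one sign and
  have bounded partial sums (a geometric sum), hence tend to \<open>0\<close>. As \<open>z\<close> is not real, two successive
  real parts determine the imaginary part, so the orbit would tend to \<open>0\<close>, although its modulus is
  constant.\<close>

lemma rotation_enters_half_plane:
  assumes "cmod z = 1" "z \<noteq> 1" "z \<noteq> -1" "q \<noteq> 0"
  shows "\<exists>k. Re (z ^ k * q) > 0"
proof (rule ccontr)
  assume "\<nexists>k. Re (z ^ k * q) > 0"
  then have neg: "Re (z ^ k * q) \<le> 0" for k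
    by (simp add: not_less)
  have "(\<Sum>k<n. \<bar>Re (z ^ k * q)\<bar>) \<le> cmod (2 * q / (z - 1))" for n
  proof -
    have "(\<Sum>k<n. \<bar>Re (z ^ k * q)\<bar>) = - Re (\<Sum>k<n. z ^ k * q)"
      unfolding Re_sum sum_negf[symmetric] using neg by (intro sum.cong) auto
    also have "(\<Sum>k<n. z ^ k * q) = (z ^ n - 1) * q / (z - 1)"
      using geometric_sum[OF \<open>z \<noteq> 1\<close>, of n] by (simp add: sum_distrib_right[symmetric])
    also have "- Re \<dots> \<le> cmod ((z ^ n - 1) * q / (z - 1))"
      using abs_Re_le_cmod[of "(z ^ n - 1) * q / (z - 1)"] by linarith
    also have "\<dots> \<le> 2 * cmod q / cmod (z - 1)"
    proof -
      have "cmod (z ^ n - 1) \<le> 2"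
        using norm_triangle_ineq4[of "z ^ n" 1] assms(1) by (simp add: norm_power)
      then show ?thesis
        unfolding norm_divide norm_mult by (intro divide_right_mono mult_right_mono) auto
    qed
    finally show ?thesis by (simp add: norm_divide norm_mult)
  qed
  then have "summable (\<lambda>k. \<bar>Re (z ^ k * q)\<bar>)"
    by (intro bounded_imp_summable[of _ "cmod (2 * q / (z - 1))"]) (simp_all only: abs_ge_zero lessThan_Suc_atMost[symmetric])
  then have Re0: "(\<lambda>k. Re (z ^ k * q)) \<longlonglongrightarrow> 0"
    using summable_LIMSEQ_zero tendsto_rabs_zero_iff by blast
  have "Im z \<noteq> 0"
  proof
    assume "Im z = 0"
    then have "\<bar>Re z\<bar> = 1"
      using assms(1) by (simp add: cmod_eq_Re)
    then show False
      using assms(2,3) \<open>Im z = 0\<close> by (auto simp: complex_eq_iff abs_if split: if_splits)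
  qed
  then have "Im (z ^ k * q) = (Re z * Re (z ^ k * q) - Re (z ^ Suc k * q)) / Im z" for k
    by (simp add: field_simps)
  then have "(\<lambda>k. Im (z ^ k * q)) \<longlonglongrightarrow> (Re z * 0 - 0) / Im z"
    using Re0 LIMSEQ_Suc[OF Re0] \<open>Im z \<noteq> 0\<close>
    by (simp only:) (intro tendsto_intros)
  then have "(\<lambda>k. z ^ k * q) \<longlonglongrightarrow> 0"
    using Re0 by (simp add: tendsto_complex_iff)
  then have "(\<lambda>k. cmod (z ^ k * q)) \<longlonglongrightarrow> 0"
    by (rule tendsto_norm_zero)
  then have "(\<lambda>k. cmod q) \<longlonglongrightarrow> 0"
    using assms(1) by (simp add: norm_mult norm_power)
  then show False
    using \<open>q \<noteq> 0\<close> by (simp add: LIMSEQ_const_iff)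
qed

text \<open>Compactness of the unit circle makes both the number of rotations and the gain uniform. The
  number \<open>\<epsilon>\<close> bounds the component of the displacement \<open>s\<close> in the direction of the rotated vector, which
  is what \<open>s\<close> adds to its modulus at the least.\<close>

lemma rotation_enters_half_plane_uniformly:
  assumes z: "cmod z = 1" "z \<noteq> 1" "z \<noteq> -1" and "s \<noteq> 0"
  obtains K and \<epsilon> :: real where "\<epsilon> > 0"
    and "\<And>u. \<exists>k\<le>K. Re (cnj s * (z ^ k * u)) \<ge> \<epsilon> * cmod u"
proof -
  define U where "U m = (\<Union>k\<le>m. {u. Re (cnj s * (z ^ k * u)) > 1 / real (Suc m)})" for m
  have "open (U m)" for m
    unfolding U_def by (intro open_UN ballI open_Collect_less continuous_intros)
  moreover have "sphere 0 1 \<subseteq> (\<Union>m. U m)"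
  proof
    fix u :: complex assume "u \<in> sphere 0 1"
    then have "cnj s * u \<noteq> 0"
      using \<open>s \<noteq> 0\<close> by auto
    then obtain k where "Re (z ^ k * (cnj s * u)) > 0"
      using rotation_enters_half_plane[OF z] by blast
    then have pos: "Re (cnj s * (z ^ k * u)) > 0"
      by (simp only: mult.left_commute)
    then obtain m where m: "1 / real (Suc m) < Re (cnj s * (z ^ k * u))"
      using nat_approx_posE by blast
    have "1 / real (Suc (max m k)) \<le> 1 / real (Suc m)"
      by (intro divide_left_mono) auto
    then have "u \<in> U (max m k)"
      using m unfolding U_def by (intro UN_I[of k]) auto
    then show "u \<in> (\<Union>m. U m)" by blast
  qed
  ultimately obtain F where F: "finite F" "sphere 0 1 \<subseteq> (\<Union>m\<in>F. U m)"
    using compactE_image[OF compact_sphere, of UNIV U] by (metis UNIV_I)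
  define K where "K = Max F"
  have "F \<noteq> {}"
    using F(2) by (auto dest!: subsetD[of _ _ 1])
  show ?thesis
  proof
    show "1 / real (Suc K) > 0" by simp
    fix u
    show "\<exists>k\<le>K. Re (cnj s * (z ^ k * u)) \<ge> 1 / real (Suc K) * cmod u"
    proof (cases "u = 0")
      case False
      define w where "w = u / of_real (cmod u)"
      have "w \<in> sphere 0 1"
        using False by (simp add: w_def norm_divide)
      then obtain m k where m: "m \<in> F" and k: "k \<le> m" "Re (cnj s * (z ^ k * w)) > 1 / real (Suc m)"
        using F(2) unfolding U_def by blast
      have "m \<le> K"
        using m F(1) by (simp add: K_def)
      then have "1 / real (Suc K) \<le> 1 / real (Suc m)"
        by (intro divide_left_mono) auto
      then have "1 / real (Suc K) * cmod u \<le> Re (cnj s * (z ^ k * w)) * cmod u"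
        using k by (intro mult_right_mono) auto
      also have "\<dots> = Re (cnj s * (z ^ k * w) * of_real (cmod u))"
        by simp
      also have "cnj s * (z ^ k * w) * of_real (cmod u) = cnj s * (z ^ k * u)"
        using False by (simp add: w_def)
      finally show ?thesis
        using k(1) \<open>m \<le> K\<close> by (intro exI[of _ k]) auto
    qed auto
  qed
qed

text \<open>The map \<open>u \<mapsto> \<theta>2 * (u + s)\<close> increases \<open>\<bar>u\<bar>\<close> by at least \<open>\<epsilon>\<close> whenever the component of
  \<open>s\<close> in the direction of \<open>u\<close> is at least \<open>\<epsilon>\<close>, while \<open>u \<mapsto> \<theta>1 * u\<close> keeps \<open>\<bar>u\<bar>\<close>. The greedy strategy applies the
  first map as soon as this gain is available. Then \<open>\<bar>u\<bar>\<close> never decreases, and the hypothesis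
  \<open>hit\<close> ensures a gain within any \<open>K + 1\<close> steps. The predicate \<open>Q\<close> confines the orbit to a region
  where \<open>hit\<close> holds; it matters for half turns, which leave a vector orthogonal to \<open>s\<close>
  orthogonal to \<open>s\<close>.\<close>

lemma greedy_escape:
  assumes \<theta>: "cmod \<theta>1 = 1" "cmod \<theta>2 = 1" and "\<epsilon> > 0"
    and inv: "\<And>u. Q u \<Longrightarrow> Q (\<theta>1 * u)" "\<And>u. Q u \<Longrightarrow> Q (\<theta>2 * (u + s))"
    and hit: "\<And>u. Q u \<Longrightarrow> \<exists>k\<le>K. Re (cnj s * (\<theta>1 ^ k * u)) \<ge> \<epsilon> * cmod u"
    and start: "Q s" "s \<noteq> 0"
  shows "\<exists>(\<tau> :: nat \<Rightarrow> bool) u c B. c > 0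
    \<and> (\<forall>n. u (Suc n) = (if \<tau> n then \<theta>2 * (u n + s) else \<theta>1 * u n))
    \<and> (\<forall>n. c * real n - B \<le> cmod (u n))"
proof -
  define moves where "moves = (\<lambda>u. Re (cnj s * u) \<ge> \<epsilon> * cmod u)"
  define step where "step = (\<lambda>u. if moves u then \<theta>2 * (u + s) else \<theta>1 * u)"
  define u where "u n = (step ^^ n) s" for n
  have u_Suc: "u (Suc n) = step (u n)" and u_0: "u 0 = s" for n
    by (simp_all add: u_def)
  have Q: "Q (u n)" for n
    by (induction n) (use inv start in \<open>auto simp: u_Suc u_0 step_def\<close>)
  have gain: "cmod w + \<epsilon> \<le> cmod (step w)" if "moves w" "w \<noteq> 0" for w
  proof -
    \<comment> \<open>Project \<open>w + s\<close> orthogonally onto the direction of \<open>w\<close>.\<close>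
    have "(cmod w + \<epsilon>) * cmod w \<le> (cmod w)\<^sup>2 + Re (cnj s * w)"
      using that by (simp add: moves_def power2_eq_square algebra_simps)
    also have "\<dots> = Re (cnj (w + s) * w)"
      by (simp add: cmod_power2) (simp add: power2_eq_square algebra_simps)
    also have "\<dots> \<le> cmod (w + s) * cmod w"
      by (metis complex_Re_le_cmod complex_mod_cnj norm_mult)
    finally show ?thesis
      using that \<theta> by (simp add: step_def norm_mult)
  qed
  have keep: "cmod (step w) = cmod w" if "\<not> moves w" for w
    using that \<theta> by (simp add: step_def norm_mult)
  have positive: "0 < cmod (u n)" for n
  proof (induction n)
    case (Suc n)
    have "cmod (u n) \<le> cmod (step (u n))"
    proof (cases "moves (u n)")
      case True
      then have "cmod (u n) + \<epsilon> \<le> cmod (step (u n))"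
        using Suc by (intro gain) auto
      then show ?thesis using \<open>\<epsilon> > 0\<close> by linarith
    qed (simp add: keep)
    then show ?case
      using Suc unfolding u_Suc by linarith
  qed (use start in \<open>simp add: u_0\<close>)
  have step_mono: "cmod (u n) \<le> cmod (u (Suc n))" for n
  proof (cases "moves (u n)")
    case True
    then have "cmod (u n) + \<epsilon> \<le> cmod (u (Suc n))"
      using positive[of n] unfolding u_Suc by (intro gain) auto
    then show ?thesis using \<open>\<epsilon> > 0\<close> by linarith
  qed (simp add: keep u_Suc)
  then have mono: "cmod (u m) \<le> cmod (u n)" if "m \<le> n" for m n
    using that by (rule lift_Suc_mono_le)
  have window: "cmod (u n) + \<epsilon> \<le> cmod (u (n + Suc K))" for n
  proof -
    have "\<exists>k\<le>K. moves (u (n + k))"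
    proof (rule ccontr)
      assume no: "\<not> (\<exists>k\<le>K. moves (u (n + k)))"
      have "u (n + k) = \<theta>1 ^ k * u n" if "k \<le> Suc K" for k
        using that
      proof (induction k)
        case (Suc k)
        then have "\<not> moves (u (n + k))" and "u (n + k) = \<theta>1 ^ k * u n"
          using no by auto
        then show ?case
          by (simp add: u_Suc step_def)
      qed simp
      then show False
        using hit[OF Q[of n]] no \<theta> by (auto simp: moves_def norm_mult norm_power)
    qed
    then obtain k where k: "k \<le> K" "moves (u (n + k))" by blast
    have "cmod (u n) + \<epsilon> \<le> cmod (u (n + k)) + \<epsilon>"
      using mono[of n "n + k"] by simp
    also have "\<dots> \<le> cmod (u (Suc (n + k)))"
      using gain k positive[of "n + k"] by (auto simp: u_Suc)
    also have "\<dots> \<le> cmod (u (n + Suc K))"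
      by (rule mono) (use k in simp)
    finally show ?thesis .
  qed
  have blocks: "real m * \<epsilon> \<le> cmod (u (m * Suc K))" for m
  proof (induction m)
    case (Suc m)
    then show ?case
      using window[of "m * Suc K"] by (simp add: algebra_simps)
  qed simp
  have "\<epsilon> / real (Suc K) * real n - \<epsilon> \<le> cmod (u n)" for n
  proof -
    have "real n \<le> real (Suc K) * (real (n div Suc K) + 1)"
    proof -
      have "n \<le> Suc K * (n div Suc K + 1)"
        using mult_div_mod_eq[of "Suc K" n] mod_less_divisor[of "Suc K" n] by (simp only: distrib_left mult_1_right) linarith
      then show ?thesis
        by (metis of_nat_1 of_nat_add of_nat_le_iff of_nat_mult)
    qed
    then have "\<epsilon> / real (Suc K) * real n \<le> \<epsilon> / real (Suc K) * (real (Suc K) * (real (n div Suc K) + 1))"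
      using \<open>\<epsilon> > 0\<close> by (intro mult_left_mono) auto
    also have "\<dots> = real (n div Suc K) * \<epsilon> + \<epsilon>"
      by (simp add: field_simps)
    also have "\<dots> \<le> cmod (u (n div Suc K * Suc K)) + \<epsilon>"
      using blocks by simp
    also have "\<dots> \<le> cmod (u n) + \<epsilon>"
      using mono[OF div_times_less_eq_dividend, of n "Suc K"] by simp
    finally show ?thesis by simp
  qed
  then show ?thesis
    using \<open>\<epsilon> > 0\<close> by (intro exI[of _ "\<lambda>n. moves (u n)"] exI[of _ u] exI[of _ "\<epsilon> / real (Suc K)"] exI[of _ \<epsilon>])
      (auto simp: u_Suc step_def)
qed

text \<open>Both maps are rotations, about \<open>0\<close> and about a point other than \<open>0\<close>. The greedy strategy works
  relative to the centre of whichever rotation is not a half turn. If both are half turns, the orbit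
  stays on the real line through \<open>0\<close> and \<open>s\<close>, and there a half turn about \<open>0\<close> suffices to reach the
  favourable direction.\<close>

lemma two_rotations_escape:
  assumes \<theta>: "cmod \<theta>1 = 1" "\<theta>1 \<noteq> 1" "cmod \<theta>2 = 1" "\<theta>2 \<noteq> 1" and "s \<noteq> 0"
  shows "\<exists>(\<tau> :: nat \<Rightarrow> bool) u c B. c > 0
    \<and> (\<forall>n. u (Suc n) = (if \<tau> n then \<theta>2 * (u n + s) else \<theta>1 * u n))
    \<and> (\<forall>n. c * real n - B \<le> cmod (u n))"
proof -
  consider "\<theta>1 \<noteq> -1" | "\<theta>1 = -1" "\<theta>2 = -1" | "\<theta>2 \<noteq> -1"
    by blast
  then show ?thesis
  proof cases
    case 1
    obtain K \<epsilon> where "\<epsilon> > 0"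
      and hit: "\<And>u. \<exists>k\<le>K. Re (cnj s * (\<theta>1 ^ k * u)) \<ge> \<epsilon> * cmod u"
      by (rule rotation_enters_half_plane_uniformly[OF \<theta>(1,2) 1 \<open>s \<noteq> 0\<close>]) (rule that)
    show ?thesis
      by (rule greedy_escape[where Q = "\<lambda>_. True" and K = K and \<epsilon> = \<epsilon>])
        (rule \<theta> \<open>\<epsilon> > 0\<close> \<open>s \<noteq> 0\<close> hit TrueI)+
  next
    case 2
    have hit: "\<exists>k\<le>1. Re (cnj s * (\<theta>1 ^ k * u)) \<ge> cmod s * cmod u" if line: "\<exists>t. u = of_real t * s" for u
    proof -
      obtain t where t: "u = of_real t * s"
        using line by blast
      have *: "Re (cnj s * (r * u)) = Re r * t * (cmod s)\<^sup>2" if "Im r = 0" for r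
        unfolding t cmod_power2 using that by (simp add: power2_eq_square algebra_simps)
      show ?thesis
      proof (cases "t \<ge> 0")
        case True
        then show ?thesis
          using *[of 1] by (intro exI[of _ 0]) (simp add: t norm_mult power2_eq_square)
      next
        case False
        then show ?thesis
          using *[of "-1"] 2 by (intro exI[of _ 1]) (simp add: t norm_mult power2_eq_square)
      qed
    qed
    have "\<exists>t'. \<theta>1 * u = of_real t' * s" "\<exists>t'. \<theta>2 * (u + s) = of_real t' * s"
      if line: "\<exists>t. u = of_real t * s" for u
    proof -
      obtain t where t: "u = of_real t * s"
        using line by blast
      show "\<exists>t'. \<theta>1 * u = of_real t' * s"
        by (rule exI[of _ "- t"]) (simp add: t 2)
      show "\<exists>t'. \<theta>2 * (u + s) = of_real t' * s"
        by (rule exI[of _ "- (t + 1)"]) (simp add: t 2 algebra_simps)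
    qed
    note stays = this
    have "\<exists>t. s = of_real t * s"
      by (rule exI[of _ 1]) simp
    moreover have "cmod s > 0"
      using \<open>s \<noteq> 0\<close> by simp
    ultimately show ?thesis
      by (intro greedy_escape[where Q = "\<lambda>u. \<exists>t. u = of_real t * s"
            and K = 1 and \<epsilon> = "cmod s"] \<theta> stays hit \<open>s \<noteq> 0\<close>)
  next
    case 3
    \<comment> \<open>The centre of the second rotation, and the displacement of the first one as seen from there.\<close>
    define p where "p = \<theta>2 * s / (1 - \<theta>2)"
    define s' where "s' = p * (\<theta>1 - 1) / \<theta>1"
    have nz: "\<theta>1 \<noteq> 0" "\<theta>2 \<noteq> 0" "1 - \<theta>2 \<noteq> 0"
      using \<theta>(1,3) \<open>\<theta>2 \<noteq> 1\<close> by (metis norm_zero zero_neq_one, metis norm_zero zero_neq_one, simp)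
    have "s' \<noteq> 0"
      using nz \<open>\<theta>1 \<noteq> 1\<close> \<open>s \<noteq> 0\<close>
      unfolding s'_def p_def divide_eq_0_iff mult_eq_0_iff right_minus_eq by blast
    obtain K \<epsilon> where "\<epsilon> > 0"
      and hit: "\<And>u. \<exists>k\<le>K. Re (cnj s' * (\<theta>2 ^ k * u)) \<ge> \<epsilon> * cmod u"
      by (rule rotation_enters_half_plane_uniformly[OF \<theta>(3,4) 3 \<open>s' \<noteq> 0\<close>]) (rule that)
    have "\<exists>(\<tau> :: nat \<Rightarrow> bool) u c B. c > 0
      \<and> (\<forall>n. u (Suc n) = (if \<tau> n then \<theta>1 * (u n + s') else \<theta>2 * u n))
      \<and> (\<forall>n. c * real n - B \<le> cmod (u n))"
      by (rule greedy_escape[where Q = "\<lambda>_. True" and K = K and \<epsilon> = \<epsilon>])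
        (rule \<theta> \<open>\<epsilon> > 0\<close> \<open>s' \<noteq> 0\<close> hit TrueI)+
    then obtain \<tau> w c B where c: "c > 0"
      and w: "\<And>n. w (Suc n) = (if \<tau> n then \<theta>1 * (w n + s') else \<theta>2 * w n)"
      and growth: "\<And>n. c * real n - B \<le> cmod (w n)"
      by blast
    have "\<theta>2 * (x + p + s) = \<theta>2 * x + p" for x
    proof -
      have "p * (1 - \<theta>2) = \<theta>2 * s"
        using nz by (simp add: p_def)
      then show ?thesis by (simp add: algebra_simps)
    qed
    moreover have "\<theta>1 * (x + p) = \<theta>1 * (x + s') + p" for x
    proof -
      have "\<theta>1 * s' = p * (\<theta>1 - 1)"
        using nz by (simp add: s'_def)
      then show ?thesis by (simp only: distrib_left) (simp add: algebra_simps)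
    qed
    moreover have "c * real n - (B + cmod p) \<le> cmod (w n + p)" for n
      using growth[of n] norm_diff_ineq[of "w n" p] by linarith
    ultimately show ?thesis
      using c by (intro exI[of _ "\<lambda>n. \<not> \<tau> n"] exI[of _ "\<lambda>n. w n + p"] exI[of _ c] exI[of _ "B + cmod p"])
        (auto simp: w)
  qed
qed

section \<open>Linear growth with a common eigenvector\<close>

text \<open>Along a sequence of triangular matrices with \<open>\<bar>d\<bar> = 1\<close> the vector stays of the form
  \<open>y (u e + f)\<close> with \<open>\<bar>y\<bar> = 1\<close>, where the slope \<open>u\<close> evolves by \<open>u \<mapsto> (a u + b) / d\<close>. Its norm is
  therefore comparable to the modulus of the slope.\<close>

lemma slope_growth:
  assumes X: "\<And>n. upper_triangular_on e f (X (Suc n)) (a n) (b n) (d n)"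
    and d: "\<And>n. cmod (d n) = 1"
    and u: "\<And>n. d n * u (Suc n) = a n * u n + b n"
  shows "cmod (wedge e f) * cmod (u n) \<le> 2 * norm f * norm (matrix_product X n *v (u 0 *s e + f))"
proof -
  have "\<exists>y. cmod y = 1 \<and> matrix_product X n *v (u 0 *s e + f) = (y * u n) *s e + y *s f"
  proof (induction n)
    case 0
    show ?case by (rule exI[of _ 1]) simp
  next
    case (Suc n)
    then obtain y where y: "cmod y = 1"
      and IH: "matrix_product X n *v (u 0 *s e + f) = (y * u n) *s e + y *s f"
      by blast
    have "matrix_product X (Suc n) *v (u 0 *s e + f) = X (Suc n) *v ((y * u n) *s e + y *s f)"
      by (simp add: IH matrix_vector_mul_assoc[symmetric])
    also have "\<dots> = (a n * (y * u n) + b n * y) *s e + (d n * y) *s f"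
      by (rule upper_triangular_on_apply[OF X])
    also have "a n * (y * u n) + b n * y = (d n * y) * u (Suc n)"
      using u[of n] by (simp add: algebra_simps)
    finally show ?case
      using y d[of n] by (intro exI[of _ "d n * y"]) (simp add: norm_mult)
  qed
  then obtain y where "cmod y = 1"
    and v: "matrix_product X n *v (u 0 *s e + f) = (y * u n) *s e + y *s f"
    by blast
  then have "cmod (wedge e f) * cmod (u n) = cmod (wedge (matrix_product X n *v (u 0 *s e + f)) f)"
    by (simp add: wedge_linear norm_mult)
  also have "\<dots> \<le> 2 * norm (matrix_product X n *v (u 0 *s e + f)) * norm f"
    by (rule norm_wedge_le)
  finally show ?thesis by (simp add: mult_ac)
qed

text \<open>The two ways in which a set with common eigenvector \<open>e\<close> fails to be simultaneously diagonalisable.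
  If some matrix has distinct eigenvalues, take for \<open>f\<close> its second eigenvector; some matrix must have
  \<open>b2 \<noteq> 0\<close> in that basis. If all matrices have a double eigenvalue, one of them is a nontrivial
  Jordan block. The value \<open>a2 = d2\<close> is possible in the first case too.\<close>

lemma non_diagonalisable_pair:
  assumes T: "\<not> simultaneously_diagonalisable T"
    and e: "common_eigenvector T e"
  obtains f M1 M2 a1 d1 a2 b2 d2 where "wedge e f \<noteq> 0" "M1 \<in> T" "M2 \<in> T"
    "upper_triangular_on e f M2 a2 b2 d2" "b2 \<noteq> 0"
    "(a2 = d2 \<and> M1 = M2) \<or> (upper_triangular_on e f M1 a1 0 d1 \<and> a1 \<noteq> d1)"
proof -
  have "e \<noteq> 0"
    using e by (simp add: common_eigenvector_def)
  have triangular: "\<exists>a b d. upper_triangular_on e f M a b d" if "M \<in> T" "wedge e f \<noteq> 0" for M f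
    using that e upper_triangular_on_exists unfolding common_eigenvector_def by metis
  have off_diagonal: "\<exists>M\<in>T. \<exists>a b d. upper_triangular_on e f M a b d \<and> b \<noteq> 0" if "wedge e f \<noteq> 0" for f
  proof (rule ccontr)
    assume no: "\<not> ?thesis"
    have "(\<exists>c. M *v e = c *s e) \<and> (\<exists>c. M *v f = c *s f)" if "M \<in> T" for M
    proof -
      obtain a b d where "upper_triangular_on e f M a b d"
        using triangular \<open>M \<in> T\<close> \<open>wedge e f \<noteq> 0\<close> by blast
      moreover from this have "b = 0"
        using no \<open>M \<in> T\<close> by blast
      ultimately show ?thesis
        by (auto simp: upper_triangular_on_def)
    qed
    then show False
      using T \<open>wedge e f \<noteq> 0\<close> unfolding simultaneously_diagonalisable_iff_eigenbasis by blast
  qed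
  \<comment> \<open>If \<open>e\<close> were parallel to both vectors of some basis, that basis would be degenerate.\<close>
  obtain f0 where f0: "wedge e f0 \<noteq> 0"
    using common_eigenvector_orthonormal_basis[OF e] parallel_if_wedge_eq_0[OF _ \<open>e \<noteq> 0\<close>]
    by (metis wedge_linear(4,5) mult_zero_right wedge_linear(3) zero_neq_one)
  show ?thesis
  proof (cases "\<exists>M\<in>T. \<exists>a b d. upper_triangular_on e f0 M a b d \<and> a \<noteq> d")
    case True
    then obtain M1 a1 b1 d1 where M1: "M1 \<in> T" "upper_triangular_on e f0 M1 a1 b1 d1" "a1 \<noteq> d1"
      by blast
    \<comment> \<open>The eigenvector of \<open>M1\<close> for \<open>d1\<close>, normalised to have coefficient \<open>1\<close> at \<open>f0\<close>.\<close>
    define f where "f = (b1 / (d1 - a1)) *s e + f0"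
    have ef: "wedge e f \<noteq> 0"
      using f0 by (simp add: f_def wedge_linear)
    have "upper_triangular_on e f M1 a1 0 d1"
    proof -
      have "M1 *v f = (a1 * (b1 / (d1 - a1)) + b1 * 1) *s e + (d1 * 1) *s f0"
        using upper_triangular_on_apply[OF M1(2), of "b1 / (d1 - a1)" 1] by (simp add: f_def)
      also have "a1 * (b1 / (d1 - a1)) + b1 * 1 = d1 * (b1 / (d1 - a1))"
        using M1(3) by (simp add: field_simps)
      finally show ?thesis
        using M1(2) by (simp add: upper_triangular_on_def f_def vector_smult_assoc vector_add_ldistrib)
    qed
    then show ?thesis
      using off_diagonal[OF ef] ef M1 that by blast
  next
    case False
    obtain M a b d where "M \<in> T" "upper_triangular_on e f0 M a b d" "b \<noteq> 0"
      using off_diagonal[OF f0] by blast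
    then show ?thesis
      using False f0 that by blast
  qed
qed

text \<open>For \<open>a2 = d2\<close> the slope map of \<open>M2\<close> is a translation, and \<open>M2\<close> alone produces linear growth.
  Otherwise the slope maps of \<open>M1\<close> and \<open>M2\<close> are rotations with different centres.\<close>

lemma linear_growth:
  fixes S :: "(complex^2^2) set"
  assumes S: "finite S" "joint_spectral_radius S \<le> 1"
    and e: "common_eigenvector S e"
    and T: "\<not> simultaneously_diagonalisable {M \<in> S. cmod (det M) = 1}"
  obtains X M1 M2 v c B where "M1 \<in> S" "cmod (det M1) = 1" "M2 \<in> S" "cmod (det M2) = 1"
    "\<And>n. X n = M1 \<or> X n = M2" "v \<noteq> 0" "c > 0"
    "\<And>n. c * real n - B \<le> norm (matrix_product X n *v v)"
proof -
  let ?T = "{M \<in> S. cmod (det M) = 1}"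
  have "common_eigenvector ?T e"
    using e by (simp add: common_eigenvector_def)
  then obtain f M1 M2 a1 d1 a2 b2 d2 where ef: "wedge e f \<noteq> 0" and M: "M1 \<in> ?T" "M2 \<in> ?T"
    and M2: "upper_triangular_on e f M2 a2 b2 d2" "b2 \<noteq> 0"
    and M1: "(a2 = d2 \<and> M1 = M2) \<or> (upper_triangular_on e f M1 a1 0 d1 \<and> a1 \<noteq> d1)"
    by (rule non_diagonalisable_pair[OF T])
  have unimodular: "cmod a = 1" "cmod d = 1" if "upper_triangular_on e f M a b d" "M \<in> ?T" for M a b d
  proof -
    have le: "cmod a \<le> 1" "cmod d \<le> 1"
      using eigenvalues_le_1[OF S _ ef that(1)] that(2) by auto
    have "cmod a * cmod d = 1"
      using upper_triangular_on_det[OF that(1) ef] that(2) by (simp add: norm_mult)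
    moreover have "cmod a * cmod d \<le> cmod a" "cmod a * cmod d \<le> cmod d"
      using le by (simp_all add: mult_left_le mult_left_le_one_le)
    ultimately show "cmod a = 1" "cmod d = 1"
      using le by linarith+
  qed
  have "\<exists>(\<tau> :: nat \<Rightarrow> bool) u c B. c > 0 \<and> (\<forall>n. c * real n - B \<le> cmod (u n)) \<and>
    (\<forall>n. if \<tau> n then d2 * u (Suc n) = a2 * u n + b2
      else upper_triangular_on e f M1 a1 0 d1 \<and> d1 * u (Suc n) = a1 * u n)"
  proof (cases "a2 = d2")
    case True
    have "cmod d2 = 1"
      using unimodular M M2 by blast
    then show ?thesis
      by (intro exI[of _ "\<lambda>_. True"] exI[of _ "\<lambda>n. of_nat n * (b2 / d2)"] exI[of _ "cmod b2"] exI[of _ 0])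
        (use M2 True in \<open>auto simp: norm_mult norm_divide field_simps\<close>)
  next
    case False
    then have M1': "upper_triangular_on e f M1 a1 0 d1" "a1 \<noteq> d1"
      using M1 by auto
    have one: "cmod a1 = 1" "cmod d1 = 1" "cmod a2 = 1" "cmod d2 = 1"
      using unimodular M M1' M2 by blast+
    then have nz: "a1 \<noteq> 0" "d1 \<noteq> 0" "a2 \<noteq> 0" "d2 \<noteq> 0"
      by auto
    have "\<exists>(\<tau> :: nat \<Rightarrow> bool) u c B. c > 0
      \<and> (\<forall>n. u (Suc n) = (if \<tau> n then (a2 / d2) * (u n + b2 / a2) else (a1 / d1) * u n))
      \<and> (\<forall>n. c * real n - B \<le> cmod (u n))"
      by (rule two_rotations_escape) (use nz one M1' M2 False in \<open>auto simp: norm_divide\<close>)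
    then obtain \<tau> :: "nat \<Rightarrow> bool" and u c B where c: "c > 0"
      and u: "\<And>n. u (Suc n) = (if \<tau> n then (a2 / d2) * (u n + b2 / a2) else (a1 / d1) * u n)"
      and growth: "\<And>n. c * real n - B \<le> cmod (u n)"
      by blast
    have "if \<tau> n then d2 * u (Suc n) = a2 * u n + b2
        else upper_triangular_on e f M1 a1 0 d1 \<and> d1 * u (Suc n) = a1 * u n" for n
      using nz M1' by (auto simp: u field_simps)
    then show ?thesis
      using c growth by blast
  qed
  then obtain \<tau> :: "nat \<Rightarrow> bool" and u c B where "c > 0"
    and growth: "\<And>n. c * real n - B \<le> cmod (u n)"
    and u: "\<And>n. if \<tau> n then d2 * u (Suc n) = a2 * u n + b2
      else upper_triangular_on e f M1 a1 0 d1 \<and> d1 * u (Suc n) = a1 * u n"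
    by blast
  \<comment> \<open>Step \<open>n\<close> of the slope sequence is carried out by the factor \<open>X (Suc n)\<close>, since products start at index \<open>1\<close>.\<close>
  define X where "X n = (if \<tau> (n - 1) then M2 else M1)" for n
  define v where "v = u 0 *s e + f"
  have bound: "cmod (wedge e f) * cmod (u n) \<le> 2 * norm f * norm (matrix_product X n *v v)" for n
    unfolding v_def
  proof (rule slope_growth)
    fix n
    let ?a = "\<lambda>n. if \<tau> n then a2 else a1" and ?b = "\<lambda>n. if \<tau> n then b2 else 0"
      and ?d = "\<lambda>n. if \<tau> n then d2 else d1"
    show tri: "upper_triangular_on e f (X (Suc n)) (?a n) (?b n) (?d n)"
      using M2 u[of n] by (auto simp: X_def)
    have "X (Suc n) \<in> ?T"
      using M by (simp add: X_def)
    with tri show "cmod (?d n) = 1"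
      using unimodular by blast
    show "?d n * u (Suc n) = ?a n * u n + ?b n"
      using u[of n] by (auto split: if_splits)
  qed
  define \<kappa> where "\<kappa> = cmod (wedge e f) / (2 * norm f)"
  have "f \<noteq> 0"
    using ef by (auto simp: wedge_def)
  then have "\<kappa> > 0"
    using ef by (simp add: \<kappa>_def)
  show ?thesis
  proof (rule that[of M1 M2 X v "\<kappa> * c" "\<kappa> * B"])
    show "v \<noteq> 0"
    proof
      assume "v = 0"
      then have "wedge e v = 0"
        by (simp add: wedge_def)
      then show False
        using ef by (simp add: v_def wedge_linear)
    qed
    fix n
    have "\<kappa> * c * real n - \<kappa> * B = \<kappa> * (c * real n - B)"
      by (simp add: algebra_simps)
    also have "\<dots> \<le> \<kappa> * cmod (u n)"
      using growth \<open>\<kappa> > 0\<close> by (intro mult_left_mono) auto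
    also have "\<dots> \<le> norm (matrix_product X n *v v)"
      using bound[of n] \<open>f \<noteq> 0\<close> by (simp add: \<kappa>_def field_simps)
    finally show "\<kappa> * c * real n - \<kappa> * B \<le> norm (matrix_product X n *v v)" .
  qed (use M \<open>\<kappa> > 0\<close> \<open>c > 0\<close> in \<open>auto simp: X_def\<close>)
qed

section \<open>The dichotomy\<close>

lemma liminf_positive_if_linear_growth:
  fixes g :: "nat \<Rightarrow> real"
  assumes "c > 0" "\<And>n. c * real n - B \<le> g n"
  shows "liminf (\<lambda>n. ereal (1 / real n * g n)) > 0"
proof -
  have "eventually (\<lambda>n. ereal (c / 2) \<le> ereal (1 / real n * g n)) sequentially"
    using eventually_ge_at_top[of "max 1 (nat \<lceil>2 * B / c\<rceil>)"]
  proof eventually_elim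
    case (elim n)
    then have n: "n \<ge> 1" "2 * B / c \<le> real n"
      by linarith+
    then have "B \<le> c / 2 * real n"
      using \<open>c > 0\<close> by (simp add: field_simps)
    then have "c / 2 * real n \<le> g n"
      using assms(2)[of n] by linarith
    then show ?case
      using n by (simp add: field_simps)
  qed
  then have "ereal (c / 2) \<le> liminf (\<lambda>n. ereal (1 / real n * g n))"
    by (rule Liminf_bounded)
  moreover have "0 < ereal (c / 2)"
    using \<open>c > 0\<close> by simp
  ultimately show ?thesis
    by (rule less_le_trans[rotated])
qed

theorem theorem1:
  fixes N :: nat and A :: "nat \<Rightarrow> complex^2^2"
  assumes "N \<ge> 1"
    and "joint_spectral_radius (A ` {1..N}) = 1"
  shows
    "((\<nexists>v. common_eigenvector (A ` {1..N}) v) \<or>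
        simultaneously_diagonalisable {A j |j. j \<in> {1..N} \<and> cmod (det (A j)) = 1} \<longrightarrow>
      (\<exists>C>0. \<forall>\<sigma> \<in> {1..} \<rightarrow> {1..N}. \<forall>v. \<forall>n\<ge>1.
         norm (matrix_product (A \<circ> \<sigma>) n *v v) \<le> C * norm v)) \<and>
     ((\<exists>v. common_eigenvector (A ` {1..N}) v) \<and>
        \<not> simultaneously_diagonalisable {A j |j. j \<in> {1..N} \<and> cmod (det (A j)) = 1} \<longrightarrow>
      (\<exists>\<sigma> \<in> {1..} \<rightarrow> {1..N}.
         (\<exists>v. v \<noteq> 0 \<and>
            liminf (\<lambda>n. ereal (1 / real n * norm (matrix_product (A \<circ> \<sigma>) n *v v))) > 0) \<and>
         \<not> simultaneously_diagonalisable {A (\<sigma> n) |n. n \<ge> 1} \<and>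
         (\<forall>n\<ge>1. cmod (det (A (\<sigma> n))) = 1) \<and>
         ((\<exists>j. \<forall>n\<ge>1. \<sigma> n = j) \<or> card (\<sigma> ` {1..}) = 2)) \<and>
      (\<forall>\<sigma> \<in> {1..} \<rightarrow> {1..N}. \<forall>v. \<forall>n\<ge>1.
         norm (matrix_product (A \<circ> \<sigma>) n *v v)
           \<le> (1 + real n * (MAX j\<in>{1..N}. matrix_norm (A j))) * norm v))"
proof (intro conjI impI)
  let ?S = "A ` {1..N}"
  let ?T = "{A j |j. j \<in> {1..N} \<and> cmod (det (A j)) = 1}"
  have S: "finite ?S" "?S \<noteq> {}" "joint_spectral_radius ?S \<le> 1"
    using assms by auto
  have T: "?T = {M \<in> ?S. cmod (det M) = 1}"
    by auto
  have products: "matrix_product (A \<circ> \<sigma>) n \<in> products_of_length ?S n" if "\<sigma> \<in> {1..} \<rightarrow> {1..N}" for \<sigma> n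
    using that by (intro matrix_product_in_products_of_length) (auto simp: Pi_iff)
  {
    assume "(\<nexists>v. common_eigenvector ?S v) \<or> simultaneously_diagonalisable ?T"
    then have "uniformly_bounded_products ?S"
      using irreducible_bounded[OF S] reducible_bounded[OF S(1,3)] unfolding T by blast
    then obtain C where "C > 0"
      and C: "\<And>n P v. P \<in> products_of_length ?S n \<Longrightarrow> norm (P *v v) \<le> C * norm v"
      unfolding uniformly_bounded_products_def by blast
    show "\<exists>C>0. \<forall>\<sigma> \<in> {1..} \<rightarrow> {1..N}. \<forall>v. \<forall>n\<ge>1.
        norm (matrix_product (A \<circ> \<sigma>) n *v v) \<le> C * norm v"
    proof (intro exI[of _ C] conjI ballI allI impI)
      fix \<sigma> :: "nat \<Rightarrow> nat" and v and n :: nat assume "\<sigma> \<in> {1..} \<rightarrow> {1..N}"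
      then show "norm (matrix_product (A \<circ> \<sigma>) n *v v) \<le> C * norm v"
        by (intro C[of _ n] products)
    qed (rule \<open>C > 0\<close>)
  }
  assume reducible: "(\<exists>v. common_eigenvector ?S v) \<and> \<not> simultaneously_diagonalisable ?T"
  then obtain e where e: "common_eigenvector ?S e"
    by blast
  show "\<forall>\<sigma> \<in> {1::nat..} \<rightarrow> {1..N}. \<forall>v. \<forall>n\<ge>1. norm (matrix_product (A \<circ> \<sigma>) n *v v)
      \<le> (1 + real n * (MAX j\<in>{1..N}. matrix_norm (A j))) * norm v"
  proof (intro ballI allI impI)
    fix \<sigma> :: "nat \<Rightarrow> nat" and v and n :: nat assume \<sigma>: "\<sigma> \<in> {1..} \<rightarrow> {1..N}"
    show "norm (matrix_product (A \<circ> \<sigma>) n *v v)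
        \<le> (1 + real n * (MAX j\<in>{1..N}. matrix_norm (A j))) * norm v"
      by (rule reducible_linear_upper_bound[OF S(1,3) e _ products[OF \<sigma>]]) auto
  qed
  have not_diagonalisable: "\<not> simultaneously_diagonalisable {M \<in> ?S. cmod (det M) = 1}"
    using reducible unfolding T by (rule conjunct2)
  obtain X M1 M2 v c B where M1: "M1 \<in> ?S" "cmod (det M1) = 1" and M2: "M2 \<in> ?S" "cmod (det M2) = 1"
    and X: "\<And>n. X n = M1 \<or> X n = M2" and v: "v \<noteq> 0" "c > 0"
    and growth: "\<And>n. c * real n - B \<le> norm (matrix_product X n *v v)"
    by (rule linear_growth[OF S(1,3) e not_diagonalisable]) (rule that)
  obtain j1 j2 where j: "j1 \<in> {1..N}" "M1 = A j1" "j2 \<in> {1..N}" "M2 = A j2"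
    using M1 M2 by blast
  define \<sigma> where "\<sigma> n = (if X n = M1 then j1 else j2)" for n :: nat
  have \<sigma>: "\<sigma> \<in> {1..} \<rightarrow> {1..N}"
    using j by (auto simp: \<sigma>_def)
  have A\<sigma>: "A (\<sigma> n) = X n" for n
    using X[of n] j by (auto simp: \<sigma>_def)
  then have "A \<circ> \<sigma> = X"
    by (simp add: fun_eq_iff)
  \<comment> \<open>Simultaneous diagonalisability would bound the products and contradict their linear growth.\<close>
  have "\<not> simultaneously_diagonalisable {A (\<sigma> n) |n. n \<ge> 1}"
  proof
    let ?R = "{A (\<sigma> n) |n. n \<ge> 1}"
    assume diagonalisable: "simultaneously_diagonalisable ?R"
    have "?R \<subseteq> {M1, M2}"
      using X by (auto simp: A\<sigma>)
    then have "?R \<subseteq> ?S"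
      using M1(1) M2(1) by blast
    then have "uniformly_bounded_products ?R"
      using diagonalisable by (intro simultaneously_diagonalisable_bounded[OF S(1,3)])
    then obtain C where C: "\<And>n P. P \<in> products_of_length ?R n \<Longrightarrow> norm (P *v v) \<le> C * norm v"
      unfolding uniformly_bounded_products_def by blast
    have "matrix_product X n \<in> products_of_length ?R n" for n
      by (rule matrix_product_in_products_of_length) (auto simp: A\<sigma>)
    then have bounded: "c * real n - B \<le> C * norm v" for n
      by (rule order_trans[OF growth C])
    obtain n where "(C * norm v + B) / c < real n"
      using reals_Archimedean2 by blast
    then have "C * norm v + B < c * real n"
      using \<open>c > 0\<close> by (simp add: pos_divide_less_eq mult.commute)
    then show False
      using bounded[of n] by linarith
  qed
  moreover have "\<forall>n\<ge>1. cmod (det (A (\<sigma> n))) = 1"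
  proof (intro allI impI)
    fix n :: nat
    show "cmod (det (A (\<sigma> n))) = 1"
      using X[of n] M1(2) M2(2) unfolding A\<sigma> by (elim disjE) simp_all
  qed
  \<comment> \<open>The strategy may happen to use one of its two letters only, in which case \<open>\<sigma>\<close> is constant.\<close>
  moreover have "(\<exists>j. \<forall>n\<ge>1. \<sigma> n = j) \<or> card (\<sigma> ` {1..}) = 2"
  proof (rule disjCI)
    assume card: "card (\<sigma> ` {1..}) \<noteq> 2"
    have range: "\<sigma> ` {1..} \<subseteq> {j1, j2}"
      by (auto simp: \<sigma>_def)
    have "\<sigma> ` {1..} \<noteq> {j1, j2} \<or> j1 = j2"
      using card by (metis card_2_iff)
    then have "\<sigma> ` {1..} \<subseteq> {j1} \<or> \<sigma> ` {1..} \<subseteq> {j2}"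
      using range by blast
    then show "\<exists>j. \<forall>n\<ge>1. \<sigma> n = j"
      by (auto simp: image_subset_iff)
  qed
  moreover have "\<exists>v. v \<noteq> 0 \<and> liminf (\<lambda>n. ereal (1 / real n * norm (matrix_product (A \<circ> \<sigma>) n *v v))) > 0"
    unfolding \<open>A \<circ> \<sigma> = X\<close>
    using liminf_positive_if_linear_growth[OF \<open>c > 0\<close> growth] \<open>v \<noteq> 0\<close> by blast
  ultimately show "\<exists>\<sigma> \<in> {1..} \<rightarrow> {1..N}.
      (\<exists>v. v \<noteq> 0 \<and> liminf (\<lambda>n. ereal (1 / real n * norm (matrix_product (A \<circ> \<sigma>) n *v v))) > 0) \<and>
      \<not> simultaneously_diagonalisable {A (\<sigma> n) |n. n \<ge> 1} \<and>
      (\<forall>n\<ge>1. cmod (det (A (\<sigma> n))) = 1) \<and>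
      ((\<exists>j. \<forall>n\<ge>1. \<sigma> n = j) \<or> card (\<sigma> ` {1..}) = 2)"
    using \<sigma> by (intro bexI[of _ \<sigma>] conjI)
qed

end
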